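(* Let $\Omega\Subset\mathbb{C}^d$ be a bounded convex domain such that $$\lim_{(z,w)\to(x,y)}\mathsf{k}_\Omega(z,w)=\infty\quad\text{for any } x\ne y\in\partial\Omega .$$ Given $p\in\Omega$, suppose that for every $\xi\in\partial\overline\Omega^{\mathsf{k}}$ the set $$\bigcap_{R>0}\overline{H_p(\xi,R)}$$ is a singleton. Then for every holomorphic map $f:\Omega\to\Omega$, either $f$ has a fixed point in $\Omega$, or there exists a point $y\in\partial\Omega$ such that $f^n\to y$ uniformly on compact subsets of $\Omega$.
   Context: $\mathsf{k}_\Omega$ is the Kobayashi distance of $\Omega$. $\partial\Omega$ and the closures $\overline{H_p(\xi,R)}$ are taken in $\mathbb{C}^d$; limits $(z,w)\to(x,y)$ are taken with $z,w\in\Omega$; $f^n$ is the $n$-th iterate of $f$. Metric compactification of $(\Omega,\mathsf{k}_\Omega)$: let $C(\Omega)$ be the real-valued continuous functions on $\Omega$ with the topology of local uniform convergence, $C_*(\Omega)$ its quotient by the constant functions with the quotient topology, and $i_{\mathsf{k}}:\Omega\to C_*(\Omega)$, $i_{\mathsf{k}}(x)=[\mathsf{k}_\Omega(x,\cdot)]$. Then $\overline\Omega^{\mathsf{k}}$ is the closure of $i_{\mathsf{k}}(\Omega)$ in $C_*(\Omega)$ and $\partial\overline\Omega^{\mathsf{k}}=\overline\Omega^{\mathsf{k}}\setminus i_{\mathsf{k}}(\Omega)$. For $\xi\in\partial\overline\Omega^{\mathsf{k}}$, $h_{p,\xi}$ is the unique function in the class $\xi$ with $h_{p,\xi}(p)=0$,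 and for $R>0$ the horoball is $H_p(\xi,R)=\{z\in\Omega: h_{p,\xi}(z)<\frac12\log R\}$. *)

theory Defs
  imports "HOL-Analysis.Analysis"
begin

section \<open>Holomorphic maps and the Kobayashi distance\<close>

text \<open>Holomorphic maps on an open subset of \<open>\<complex>\<^sup>d\<close>: complex Frechet differentiability, i.e.
  the real derivative \<open>D\<close> exists and is complex homogeneous.\<close>

definition holomorphic_map_on ::
  "(complex ^ 'n \<Rightarrow> complex ^ 'm) \<Rightarrow> (complex ^ 'n) set \<Rightarrow> bool" where
  "holomorphic_map_on f S \<longleftrightarrow>
     (\<forall>z\<in>S. \<exists>D. (f has_derivative D) (at z within S) \<and> (\<forall>c v. D (c *s v) = c *s D v))"

definition holomorphic_disc :: "(complex ^ 'n) set \<Rightarrow> (complex \<Rightarrow> complex ^ 'n) \<Rightarrow> bool" where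
  "holomorphic_disc \<Omega> \<phi> \<longleftrightarrow>
     (\<forall>i. (\<lambda>\<zeta>. \<phi> \<zeta> $ i) holomorphic_on ball 0 1) \<and> \<phi> ` ball 0 1 \<subseteq> \<Omega>"

text \<open>The Poincare distance of the unit disc, in the normalization
  \<open>\<rho>(0, r) = 1/2 ln ((1 + r) / (1 - r))\<close> (curvature \<open>-4\<close>).\<close>

definition poincare_dist :: "complex \<Rightarrow> complex \<Rightarrow> real" where
  "poincare_dist a b = artanh (cmod ((a - b) / (1 - cnj a * b)))"

text \<open>The infimum of the Poincare lengths of finite chains of holomorphic discs in \<open>\<Omega>\<close> that
  join \<open>z\<close> to \<open>w\<close>. For \<open>z\<close> and \<open>w\<close> in a domain \<open>\<Omega>\<close> such chains exist, so this is the infimum of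
  a nonempty set of nonnegative reals; otherwise the value is meaningless.\<close>

definition kobayashi_dist :: "(complex ^ 'n) set \<Rightarrow> complex ^ 'n \<Rightarrow> complex ^ 'n \<Rightarrow> real" where
  "kobayashi_dist \<Omega> z w = Inf {(\<Sum>j<m. poincare_dist (a j) (b j)) | m a b.
     m > 0 \<and> (\<forall>j<m. a j \<in> ball 0 1 \<and> b j \<in> ball 0 1) \<and>
     (\<exists>u \<phi>. u 0 = z \<and> u m = w \<and>
        (\<forall>j<m. holomorphic_disc \<Omega> (\<phi> j) \<and> \<phi> j (a j) = u j \<and> \<phi> j (b j) = u (Suc j)))}"

section \<open>The space of continuous functions modulo constants\<close>

text \<open>Functions on \<open>\<Omega>\<close> are represented by total functions that are \<open>undefined\<close> outside \<open>\<Omega>\<close>,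
  so that equality is equality on \<open>\<Omega>\<close>.\<close>

definition cont_funs :: "(complex ^ 'n) set \<Rightarrow> (complex ^ 'n \<Rightarrow> real) set" where
  "cont_funs \<Omega> = {f \<in> extensional \<Omega>. continuous_on \<Omega> f}"

text \<open>Since an open \<open>\<Omega>\<close> is locally compact, local uniform convergence is uniform convergence on
  compact subsets.\<close>

definition loc_unif_topology :: "(complex ^ 'n) set \<Rightarrow> (complex ^ 'n \<Rightarrow> real) topology" where
  "loc_unif_topology \<Omega> = topology (\<lambda>U. U \<subseteq> cont_funs \<Omega> \<and>
     (\<forall>f\<in>U. \<exists>K \<epsilon>. compact K \<and> K \<subseteq> \<Omega> \<and> \<epsilon> > 0 \<and>
        {g \<in> cont_funs \<Omega>. \<forall>x\<in>K. \<bar>g x - f x\<bar> < \<epsilon>} \<subseteq> U))"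

lemma openin_loc_unif_topology:
  "openin (loc_unif_topology \<Omega>) U \<longleftrightarrow> U \<subseteq> cont_funs \<Omega> \<and>
     (\<forall>f\<in>U. \<exists>K \<epsilon>. compact K \<and> K \<subseteq> \<Omega> \<and> \<epsilon> > 0 \<and>
        {g \<in> cont_funs \<Omega>. \<forall>x\<in>K. \<bar>g x - f x\<bar> < \<epsilon>} \<subseteq> U)"
proof -
  let ?B = "\<lambda>f K \<epsilon>. {g \<in> cont_funs \<Omega>. \<forall>x\<in>K. \<bar>g x - f x\<bar> < \<epsilon>}"
  let ?nb = "\<lambda>U f. \<exists>K \<epsilon>. compact K \<and> K \<subseteq> \<Omega> \<and> \<epsilon> > 0 \<and> ?B f K \<epsilon> \<subseteq> U"
  have "istopology (\<lambda>U. U \<subseteq> cont_funs \<Omega> \<and> (\<forall>f\<in>U. ?nb U f))"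
    unfolding istopology_def
  proof (intro conjI allI impI)
    fix S T assume S: "S \<subseteq> cont_funs \<Omega> \<and> (\<forall>f\<in>S. ?nb S f)"
      and T: "T \<subseteq> cont_funs \<Omega> \<and> (\<forall>f\<in>T. ?nb T f)"
    show "S \<inter> T \<subseteq> cont_funs \<Omega>" using S by blast
    show "\<forall>f\<in>S \<inter> T. ?nb (S \<inter> T) f"
    proof
      fix f assume f: "f \<in> S \<inter> T"
      obtain K \<epsilon> where 1: "compact K" "K \<subseteq> \<Omega>" "\<epsilon> > 0" "?B f K \<epsilon> \<subseteq> S"
        using S f by blast
      obtain L \<delta> where 2: "compact L" "L \<subseteq> \<Omega>" "\<delta> > 0" "?B f L \<delta> \<subseteq> T"
        using T f by blast
      have "?B f (K \<union> L) (min \<epsilon> \<delta>) \<subseteq> ?B f K \<epsilon> \<inter> ?B f L \<delta>" by auto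
      with 1 2 have "compact (K \<union> L) \<and> K \<union> L \<subseteq> \<Omega> \<and> min \<epsilon> \<delta> > 0
          \<and> ?B f (K \<union> L) (min \<epsilon> \<delta>) \<subseteq> S \<inter> T"
        by (intro conjI compact_Un) auto
      then show "?nb (S \<inter> T) f" by blast
    qed
  next
    fix \<K> assume K: "\<forall>S\<in>\<K>. S \<subseteq> cont_funs \<Omega> \<and> (\<forall>f\<in>S. ?nb S f)"
    show "\<Union>\<K> \<subseteq> cont_funs \<Omega>" using K by blast
    show "\<forall>f\<in>\<Union>\<K>. ?nb (\<Union>\<K>) f"
    proof
      fix f assume "f \<in> \<Union>\<K>"
      then obtain S where "S \<in> \<K>" "f \<in> S" by blast
      with K have "?nb S f" by blast
      with \<open>S \<in> \<K>\<close> show "?nb (\<Union>\<K>) f" by (meson Sup_upper subset_trans)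
    qed
  qed
  then show ?thesis by (simp add: loc_unif_topology_def topology_inverse')
qed

definition const_rel ::
  "(complex ^ 'n) set \<Rightarrow> ((complex ^ 'n \<Rightarrow> real) \<times> (complex ^ 'n \<Rightarrow> real)) set" where
  "const_rel \<Omega> = {(f, g). f \<in> cont_funs \<Omega> \<and> g \<in> cont_funs \<Omega> \<and> (\<exists>c. \<forall>x\<in>\<Omega>. g x = f x + c)}"

text \<open>The quotient topology: a set of classes is open iff its preimage under the projection, i.e.
  its union, is open.\<close>

definition cont_funs_mod_const_topology ::
  "(complex ^ 'n) set \<Rightarrow> (complex ^ 'n \<Rightarrow> real) set topology" where
  "cont_funs_mod_const_topology \<Omega> = topology (\<lambda>\<U>. \<U> \<subseteq> cont_funs \<Omega> // const_rel \<Omega> \<and>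
     openin (loc_unif_topology \<Omega>) (\<Union>\<U>))"

lemma equiv_const_rel: "equiv (cont_funs \<Omega>) (const_rel \<Omega>)"
proof (rule equivI)
  show "const_rel \<Omega> \<subseteq> cont_funs \<Omega> \<times> cont_funs \<Omega>" by (auto simp: const_rel_def)
  show "refl_on (cont_funs \<Omega>) (const_rel \<Omega>)"
    by (auto simp: refl_on_def const_rel_def intro: exI[of _ 0])
  show "sym (const_rel \<Omega>)"
    by (rule symI) (auto simp: const_rel_def intro: exI[of _ "- c" for c])
  show "trans (const_rel \<Omega>)"
  proof (rule transI)
    fix f g h assume "(f, g) \<in> const_rel \<Omega>" "(g, h) \<in> const_rel \<Omega>"
    then obtain c d where "f \<in> cont_funs \<Omega>" "h \<in> cont_funs \<Omega>"
      "\<forall>x\<in>\<Omega>. g x = f x + c" "\<forall>x\<in>\<Omega>. h x = g x + d"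
      unfolding const_rel_def by blast
    then show "(f, h) \<in> const_rel \<Omega>"
      by (auto simp: const_rel_def intro!: exI[of _ "c + d"])
  qed
qed

lemma openin_cont_funs_mod_const_topology:
  "openin (cont_funs_mod_const_topology \<Omega>) \<U> \<longleftrightarrow>
     \<U> \<subseteq> cont_funs \<Omega> // const_rel \<Omega> \<and> openin (loc_unif_topology \<Omega>) (\<Union>\<U>)"
proof -
  have "istopology (\<lambda>\<U>. \<U> \<subseteq> cont_funs \<Omega> // const_rel \<Omega> \<and>
     openin (loc_unif_topology \<Omega>) (\<Union>\<U>))"
    unfolding istopology_def
  proof (intro conjI allI impI)
    fix S T
    assume S: "S \<subseteq> cont_funs \<Omega> // const_rel \<Omega> \<and> openin (loc_unif_topology \<Omega>) (\<Union>S)"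
      and T: "T \<subseteq> cont_funs \<Omega> // const_rel \<Omega> \<and> openin (loc_unif_topology \<Omega>) (\<Union>T)"
    show "S \<inter> T \<subseteq> cont_funs \<Omega> // const_rel \<Omega>" using S by blast
    have "\<Union>(S \<inter> T) = \<Union>S \<inter> \<Union>T"
    proof
      show "\<Union>S \<inter> \<Union>T \<subseteq> \<Union>(S \<inter> T)"
      proof
        fix f assume "f \<in> \<Union>S \<inter> \<Union>T"
        then obtain X Y where XY: "X \<in> S" "Y \<in> T" "f \<in> X" "f \<in> Y" by blast
        moreover have "X \<in> cont_funs \<Omega> // const_rel \<Omega>" "Y \<in> cont_funs \<Omega> // const_rel \<Omega>"
          using XY S T by auto
        ultimately have "X = Y" using quotient_disj[OF equiv_const_rel] by blast
        with XY show "f \<in> \<Union>(S \<inter> T)" by blast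
      qed
    qed blast
    then show "openin (loc_unif_topology \<Omega>) (\<Union>(S \<inter> T))" using S T by (simp add: openin_Int)
  next
    fix \<K>
    assume K: "\<forall>S\<in>\<K>. S \<subseteq> cont_funs \<Omega> // const_rel \<Omega> \<and> openin (loc_unif_topology \<Omega>) (\<Union>S)"
    then show "\<Union>\<K> \<subseteq> cont_funs \<Omega> // const_rel \<Omega>" by blast
    have "\<Union>(\<Union>\<K>) = \<Union>(Union ` \<K>)" by blast
    with K show "openin (loc_unif_topology \<Omega>) (\<Union>(\<Union>\<K>))" by (simp only:) (blast intro: openin_Union)
  qed
  then show ?thesis by (simp add: cont_funs_mod_const_topology_def topology_inverse')
qed

section \<open>The metric compactification and horoballs\<close>

definition metric_embedding ::
  "(complex ^ 'n) set \<Rightarrow> complex ^ 'n \<Rightarrow> (complex ^ 'n \<Rightarrow> real) set" where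
  "metric_embedding \<Omega> x = const_rel \<Omega> `` {restrict (kobayashi_dist \<Omega> x) \<Omega>}"

definition metric_compactification ::
  "(complex ^ 'n) set \<Rightarrow> (complex ^ 'n \<Rightarrow> real) set set" where
  "metric_compactification \<Omega> =
     cont_funs_mod_const_topology \<Omega> closure_of (metric_embedding \<Omega> ` \<Omega>)"

definition metric_boundary :: "(complex ^ 'n) set \<Rightarrow> (complex ^ 'n \<Rightarrow> real) set set" where
  "metric_boundary \<Omega> = metric_compactification \<Omega> - metric_embedding \<Omega> ` \<Omega>"

definition horofunction :: "complex ^ 'n \<Rightarrow> (complex ^ 'n \<Rightarrow> real) set \<Rightarrow> complex ^ 'n \<Rightarrow> real" where
  "horofunction p \<xi> = (THE h. h \<in> \<xi> \<and> h p = 0)"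

definition horoball ::
  "(complex ^ 'n) set \<Rightarrow> complex ^ 'n \<Rightarrow> (complex ^ 'n \<Rightarrow> real) set \<Rightarrow> real \<Rightarrow> (complex ^ 'n) set" where
  "horoball \<Omega> p \<xi> R = {z \<in> \<Omega>. horofunction p \<xi> z < 1 / 2 * ln R}"

lemma ex1_horofunction:
  assumes "p \<in> \<Omega>" and "\<xi> \<in> cont_funs \<Omega> // const_rel \<Omega>"
  shows "\<exists>!h. h \<in> \<xi> \<and> h p = 0"
proof -
  obtain f where f: "f \<in> cont_funs \<Omega>" and \<xi>: "\<xi> = const_rel \<Omega> `` {f}"
    using assms(2) by (elim quotientE)
  define h where "h = restrict (\<lambda>x. f x - f p) \<Omega>"
  have "h \<in> cont_funs \<Omega>"
    using f by (auto simp: h_def cont_funs_def intro!: continuous_intros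
        cong: continuous_on_cong)
  then have "h \<in> \<xi>"
    using f by (auto simp: \<xi> const_rel_def h_def intro!: exI[of _ "- f p"])
  moreover have "h p = 0" using assms(1) by (simp add: h_def)
  moreover have "g = h" if g: "g \<in> \<xi>" "g p = 0" for g
  proof (rule extensionalityI[of _ \<Omega>])
    show "g \<in> extensional \<Omega>" using g by (auto simp: \<xi> const_rel_def cont_funs_def)
    show "h \<in> extensional \<Omega>" by (simp add: h_def)
    obtain c where c: "\<forall>x\<in>\<Omega>. g x = f x + c" using g by (auto simp: \<xi> const_rel_def)
    show "g x = h x" if "x \<in> \<Omega>" for x
      using c assms(1) g(2) that by (auto simp: h_def)
  qed
  ultimately show ?thesis by blast
qed

end

theory Submission
  imports Defs "HOL-Complex_Analysis.Riemann_Mapping"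
begin

text \<open>
  The Kobayashi distance \<open>k\<close> makes a bounded convex domain a length space (it is defined by chains
  of discs, and a chain can be cut anywhere) and a proper one (at a boundary point a supporting
  complex half-plane forces \<open>k\<close> to infinity), and every holomorphic self-map \<open>f\<close> is nonexpansive
  for it. From there on the argument is metric.

  Suppose that \<open>f\<close> has no fixed point. The maps \<open>(1 - t) f + t p\<close> send the domain into a compact
  convex part of it, so by Brouwer they have fixed points \<open>x\<^sub>t\<close>, and \<open>x\<^sub>t\<close> leaves
  every compact set as \<open>t\<close> tends to \<open>0\<close>, because a limit inside would be fixed by \<open>f\<close>. Balls
  centred at \<open>x\<^sub>t\<close> are invariant under the contracted map; in the limit of a subsequence they become
  the sublevel sets of a horofunction \<open>h\<close> with \<open>h \<circ> f \<le> h\<close> (\<open>invariant_horofunction\<close>). So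
  each orbit stays in a horoball.

  A point of any horoball can be moved by a bounded distance into an arbitrarily small one
  (\<open>horofunction_descent\<close>), and since \<open>k(z, w)\<close> blows up when \<open>z\<close> and \<open>w\<close> approach distinct
  boundary points, a displacement of bounded length does not change a limit on the boundary
  (\<open>boundary_limit_of_bounded_distance\<close>). So a boundary point in the closure of one horoball of \<open>h\<close>
  lies in the closures of all of them, and the singleton hypothesis leaves only one candidate \<open>y\<close>.

  It remains to see that the orbit of \<open>p\<close> accumulates only on the boundary. If it returned infinitely
  often to a bounded set, it would be bounded by a theorem of Calka (\<open>Calka_bounded_orbit\<close>).
  Since Kobayashi balls of a convex domain are convex, a bounded orbit has an invariant compact
  convex set of asymptotic centres, on which Brouwer gives a fixed point of \<open>f\<close>
  (\<open>fixed_point_if_orbit_bounded\<close>), a contradiction. So the orbit of \<open>p\<close> tends to \<open>y\<close>; the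
  orbits of the points of a compact set stay at bounded distance from it and follow it uniformly.
\<close>

section \<open>Discs joining two points\<close>

lemma tanh_artanh_real:
  fixes x :: real
  assumes "\<bar>x\<bar> < 1"
  shows "tanh (artanh x) = x"
proof -
  have p: "(1 + x) / (1 - x) > 0" using assms by (auto simp: abs_if divide_simps split: if_splits)
  have "exp (- 2 * artanh x) = inverse ((1 + x) / (1 - x))"
    using p by (simp add: artanh_def exp_minus)
  then have E: "exp (- 2 * artanh x) = (1 - x) / (1 + x)" by simp
  show ?thesis unfolding tanh_real_altdef E using assms by (simp add: field_simps)
qed

lemma norm_vector_scalar_mult:
  fixes v :: "complex ^ 'n"
  shows "norm (c *s v) = cmod c * norm v"
  by (simp add: norm_vec_def norm_mult L2_set_right_distrib)

lemma holomorphic_disc_compose: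
  assumes "holomorphic_disc \<Omega> \<phi>" and "m holomorphic_on ball 0 1" and "m ` ball 0 1 \<subseteq> ball 0 1"
  shows "holomorphic_disc \<Omega> (\<phi> \<circ> m)"
  unfolding holomorphic_disc_def
proof (intro conjI allI)
  fix i
  have "((\<lambda>\<zeta>. \<phi> \<zeta> $ i) \<circ> m) holomorphic_on ball 0 1"
    using assms by (intro holomorphic_on_compose_gen[where t = "ball 0 1"])
      (auto simp: holomorphic_disc_def)
  then show "(\<lambda>\<zeta>. (\<phi> \<circ> m) \<zeta> $ i) holomorphic_on ball 0 1" by (simp add: o_def)
  show "(\<phi> \<circ> m) ` ball 0 1 \<subseteq> \<Omega>" using assms by (force simp: holomorphic_disc_def)
qed

text \<open>One link of a chain of discs, normalized by an automorphism of the disc: the Poincare distance of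
  \<open>0\<close> and \<open>tanh l\<close> is \<open>l\<close>. Using the length itself as a parameter, with the value \<open>0\<close> included,
  makes links easy to cut and to compare.\<close>

definition disc_joined ::
  "(complex ^ 'n) set \<Rightarrow> real \<Rightarrow> complex ^ 'n \<Rightarrow> complex ^ 'n \<Rightarrow> bool" where
  "disc_joined \<Omega> l z w \<longleftrightarrow>
     l \<ge> 0 \<and> (\<exists>\<phi>. holomorphic_disc \<Omega> \<phi> \<and> \<phi> 0 = z \<and> \<phi> (of_real (tanh l)) = w)"

lemma tanh_in_ball: "of_real (tanh l) \<in> ball (0::complex) 1"
  by (simp add: abs_less_iff tanh_real_lt_1 tanh_real_gt_neg1 minus_less_iff)

lemma disc_joined_mem:
  assumes "disc_joined \<Omega> l z w"
  shows "z \<in> \<Omega>" and "w \<in> \<Omega>"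
  using assms tanh_in_ball[of l] unfolding disc_joined_def holomorphic_disc_def by force+

lemma disc_joined_refl: "z \<in> \<Omega> \<Longrightarrow> l \<ge> 0 \<Longrightarrow> disc_joined \<Omega> l z z"
  unfolding disc_joined_def holomorphic_disc_def by (auto intro!: exI[of _ "\<lambda>_. z"])

lemma disc_joined_0: "disc_joined \<Omega> 0 z w \<Longrightarrow> z = w"
  by (auto simp: disc_joined_def)

lemma Moebius_norm_less_1:
  assumes "a \<in> ball 0 1" and "b \<in> ball 0 1"
  shows "cmod ((a - b) / (1 - cnj a * b)) < 1"
  using Moebius_function_norm_lt_1[of a b 0] assms
  by (simp add: Moebius_function_simple norm_divide norm_minus_commute)

text \<open>Automorphisms of the disc act transitively on pairs of points at a given Poincare distance: a
  rotation followed by a Moebius function sends \<open>0\<close> to \<open>a\<close> and the point \<open>r\<close> of the positive axis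
  to \<open>b\<close>, where \<open>r\<close> is the pseudo-hyperbolic distance of \<open>a\<close> and \<open>b\<close>.\<close>

lemma disc_joined_poincare_dist:
  assumes \<phi>: "holomorphic_disc \<Omega> \<phi>" and a: "a \<in> ball 0 1" and b: "b \<in> ball 0 1"
  shows "disc_joined \<Omega> (poincare_dist a b) (\<phi> a) (\<phi> b)"
proof -
  define c where "c = Moebius_function 0 a b"
  define r where "r = cmod c"
  have r: "r = cmod ((a - b) / (1 - cnj a * b))"
    by (simp add: r_def c_def Moebius_function_simple norm_divide norm_minus_commute)
  have r1: "r < 1" "r \<ge> 0" using Moebius_norm_less_1[OF a b] by (simp_all add: r[symmetric] r_def)
  have ar: "artanh r \<ge> 0" using r1 by (simp add: artanh_def divide_simps)
  define e where "e = (if c = 0 then 1 else sgn c)"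
  have e: "cmod e = 1" "e * of_real r = c"
    by (simp_all add: e_def norm_sgn r_def) (simp add: sgn_eq)
  define m where "m = (\<lambda>\<zeta>. Moebius_function 0 (- a) (e * \<zeta>))"
  have "(Moebius_function 0 (- a) \<circ> (\<lambda>\<zeta>. e * \<zeta>)) holomorphic_on ball 0 1"
    using a e by (intro holomorphic_on_compose_gen[OF _ Moebius_function_holomorphic])
      (auto intro!: holomorphic_intros simp: norm_mult)
  then have m: "m holomorphic_on ball 0 1" by (simp add: m_def o_def)
  have mb: "m ` ball 0 1 \<subseteq> ball 0 1"
    using a e by (auto simp: m_def norm_mult intro!: Moebius_function_norm_lt_1)
  have m0: "m 0 = a" by (simp add: m_def Moebius_function_simple)
  have mr: "m (of_real r) = b"
    using Moebius_function_compose[of "- a" a b] a b by (simp add: m_def e c_def)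
  have t: "tanh (artanh r) = r" using r1 by (intro tanh_artanh_real) auto
  have "disc_joined \<Omega> (artanh r) (\<phi> a) (\<phi> b)"
    unfolding disc_joined_def
    using holomorphic_disc_compose[OF \<phi> m mb] ar by (intro conjI exI[of _ "\<phi> \<circ> m"]) (simp_all add: t m0 mr)
  then show ?thesis by (simp add: poincare_dist_def r)
qed

lemma poincare_dist_tanh:
  assumes "s \<ge> 0" and "t \<ge> 0"
  shows "poincare_dist (of_real (tanh s)) (of_real (tanh (s + t))) = t"
    and "poincare_dist (of_real (tanh t)) 0 = t"
proof -
  have "tanh t = (tanh (s + t) - tanh s) / (1 - tanh (s + t) * tanh s)"
    using tanh_add[of "s + t" "- s"] by simp
  then have "(tanh s - tanh (s + t)) / (1 - tanh s * tanh (s + t)) = - tanh t"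
    by (metis minus_diff_eq minus_divide_left mult.commute)
  moreover have "(of_real (tanh s) - of_real (tanh (s + t))) /
      (1 - cnj (of_real (tanh s)) * of_real (tanh (s + t))) =
      (of_real ((tanh s - tanh (s + t)) / (1 - tanh s * tanh (s + t))) :: complex)"
    by simp
  ultimately show "poincare_dist (of_real (tanh s)) (of_real (tanh (s + t))) = t"
    using assms unfolding poincare_dist_def by (simp add: norm_of_real artanh_tanh_real del: of_real_divide)
  show "poincare_dist (of_real (tanh t)) 0 = t"
    using assms by (simp add: poincare_dist_def artanh_tanh_real)
qed

lemma disc_joined_sym:
  assumes "disc_joined \<Omega> l z w"
  shows "disc_joined \<Omega> l w z"
proof -
  obtain \<phi> where "l \<ge> 0" "holomorphic_disc \<Omega> \<phi>" "\<phi> 0 = z" "\<phi> (of_real (tanh l)) = w"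
    using assms by (auto simp: disc_joined_def)
  then show ?thesis
    using disc_joined_poincare_dist[of \<Omega> \<phi> "of_real (tanh l)" 0] tanh_in_ball[of l]
    by (simp add: poincare_dist_tanh(2)[of 0])
qed

text \<open>The radius from \<open>0\<close> to \<open>tanh (s + t)\<close> is a geodesic of the disc, so the image of the point
  \<open>tanh s\<close> divides the link.\<close>

lemma disc_joined_split:
  assumes "disc_joined \<Omega> (s + t) z w" and "s \<ge> 0" and "t \<ge> 0"
  obtains u where "disc_joined \<Omega> s z u" and "disc_joined \<Omega> t u w"
proof -
  obtain \<phi> where \<phi>: "holomorphic_disc \<Omega> \<phi>" "\<phi> 0 = z" "\<phi> (of_real (tanh (s + t))) = w"
    using assms by (auto simp: disc_joined_def)
  have "disc_joined \<Omega> s z (\<phi> (of_real (tanh s)))"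
    using \<phi> assms by (auto simp: disc_joined_def)
  moreover have "disc_joined \<Omega> t (\<phi> (of_real (tanh s))) w"
    using disc_joined_poincare_dist[OF \<phi>(1) tanh_in_ball[of s] tanh_in_ball[of "s + t"]]
      \<phi>(3) assms by (simp only: poincare_dist_tanh)
  ultimately show ?thesis by (rule that)
qed

text \<open>Two links of the same length have the same parameters \<open>0\<close> and \<open>tanh l\<close>, so a convex combination
  of the two discs joins the convex combinations of the end points.\<close>

lemma disc_joined_convex:
  assumes "convex \<Omega>" and "disc_joined \<Omega> l z w" and "disc_joined \<Omega> l z' w'"
    and "0 \<le> a" and "0 \<le> b" and "a + b = 1"
  shows "disc_joined \<Omega> l (a *\<^sub>R z + b *\<^sub>R z') (a *\<^sub>R w + b *\<^sub>R w')"
proof -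
  obtain \<phi> where \<phi>: "l \<ge> 0" "holomorphic_disc \<Omega> \<phi>" "\<phi> 0 = z" "\<phi> (of_real (tanh l)) = w"
    using assms(2) by (auto simp: disc_joined_def)
  obtain \<psi> where \<psi>: "holomorphic_disc \<Omega> \<psi>" "\<psi> 0 = z'" "\<psi> (of_real (tanh l)) = w'"
    using assms(3) by (auto simp: disc_joined_def)
  have "holomorphic_disc \<Omega> (\<lambda>\<zeta>. a *\<^sub>R \<phi> \<zeta> + b *\<^sub>R \<psi> \<zeta>)"
    unfolding holomorphic_disc_def
  proof (intro conjI allI)
    show "(\<lambda>\<zeta>. (a *\<^sub>R \<phi> \<zeta> + b *\<^sub>R \<psi> \<zeta>) $ i) holomorphic_on ball 0 1" for i
      using \<phi>(2) \<psi>(1) unfolding holomorphic_disc_def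
      by (auto simp: scaleR_conv_of_real intro!: holomorphic_intros)
    show "(\<lambda>\<zeta>. a *\<^sub>R \<phi> \<zeta> + b *\<^sub>R \<psi> \<zeta>) ` ball 0 1 \<subseteq> \<Omega>"
      using \<phi>(2) \<psi>(1) assms unfolding holomorphic_disc_def by (auto intro!: convexD)
  qed
  then show ?thesis unfolding disc_joined_def using \<phi> \<psi> by blast
qed

lemma disc_joined_ball:
  assumes "ball z r \<subseteq> \<Omega>" and "dist z w < r"
  shows "disc_joined \<Omega> (artanh (dist z w / r)) z w"
proof (cases "z = w")
  case True
  then show ?thesis using assms by (auto intro!: disc_joined_refl)
next
  case False
  define \<rho> where "\<rho> = dist z w / r"
  have r: "r > 0" "dist z w > 0" using False assms le_less_trans[OF zero_le_dist assms(2)] by auto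
  have \<rho>: "0 < \<rho>" "\<rho> < 1" unfolding \<rho>_def
    using divide_pos_pos[OF r(2,1)] assms(2) divide_less_eq_1_pos[OF r(1)] by blast+
  define v where "v = (1 / \<rho>) *\<^sub>R (w - z)"
  have v: "norm v = r" using r by (simp add: v_def \<rho>_def dist_norm norm_minus_commute)
  define \<phi> where "\<phi> \<zeta> = z + \<zeta> *s v" for \<zeta>
  have "holomorphic_disc \<Omega> \<phi>"
    unfolding holomorphic_disc_def
  proof (intro conjI allI)
    show "(\<lambda>\<zeta>. \<phi> \<zeta> $ i) holomorphic_on ball 0 1" for i
      unfolding \<phi>_def by (auto intro!: holomorphic_intros)
    have "\<phi> \<zeta> \<in> ball z r" if "\<zeta> \<in> ball 0 1" for \<zeta>
      using that r by (simp add: \<phi>_def dist_norm norm_vector_scalar_mult v)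
    then show "\<phi> ` ball 0 1 \<subseteq> \<Omega>" using assms(1) by blast
  qed
  moreover have "of_real \<rho> *s v = \<rho> *\<^sub>R v"
    by (simp add: vec_eq_iff scaleR_conv_of_real[of _ "_ :: complex"])
  then have "of_real \<rho> *s v = w - z" using \<rho> by (simp add: v_def)
  moreover have "artanh \<rho> \<ge> 0" using \<rho> by (simp add: artanh_def divide_simps)
  ultimately show ?thesis
    using \<rho> unfolding disc_joined_def \<rho>_def[symmetric]
    by (auto simp: tanh_artanh_real \<phi>_def intro!: exI[of _ \<phi>])
qed

section \<open>Chains of discs\<close>

fun chain_joined ::
  "(complex ^ 'n) set \<Rightarrow> real list \<Rightarrow> complex ^ 'n \<Rightarrow> complex ^ 'n \<Rightarrow> bool" where
  "chain_joined \<Omega> [] z w \<longleftrightarrow> z \<in> \<Omega> \<and> z = w"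
| "chain_joined \<Omega> (l # ls) z w \<longleftrightarrow> (\<exists>u. disc_joined \<Omega> l z u \<and> chain_joined \<Omega> ls u w)"

lemma chain_joined_mem: "chain_joined \<Omega> ls z w \<Longrightarrow> z \<in> \<Omega> \<and> w \<in> \<Omega>"
  by (induction ls arbitrary: z) (auto dest: disc_joined_mem)

lemma chain_joined_nonneg: "chain_joined \<Omega> ls z w \<Longrightarrow> sum_list ls \<ge> 0"
  by (induction ls arbitrary: z) (auto simp: disc_joined_def intro!: add_nonneg_nonneg)

lemma chain_joined_append:
  "chain_joined \<Omega> ls z u \<Longrightarrow> chain_joined \<Omega> ls' u w \<Longrightarrow> chain_joined \<Omega> (ls @ ls') z w"
  by (induction ls arbitrary: z) auto

lemma chain_joined_rev: "chain_joined \<Omega> ls z w \<Longrightarrow> chain_joined \<Omega> (rev ls) w z"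
proof (induction ls arbitrary: z)
  case (Cons l ls)
  then obtain u where u: "disc_joined \<Omega> l z u" "chain_joined \<Omega> ls u w" by auto
  then have "chain_joined \<Omega> [l] u z"
    using disc_joined_mem by (auto intro!: exI[of _ z] disc_joined_sym)
  then show ?case using chain_joined_append[OF Cons.IH[OF u(2)]] by simp
qed auto

lemma chain_joined_sum_0: "chain_joined \<Omega> ls z w \<Longrightarrow> sum_list ls = 0 \<Longrightarrow> z = w"
proof (induction ls arbitrary: z)
  case (Cons l ls)
  then obtain u where u: "disc_joined \<Omega> l z u" "chain_joined \<Omega> ls u w" by auto
  have "l \<ge> 0" "sum_list ls \<ge> 0" using u chain_joined_nonneg by (auto simp: disc_joined_def)
  then have "l = 0" "sum_list ls = 0" using Cons.prems by auto
  then show ?case using u Cons.IH disc_joined_0 by blast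
qed auto

lemma chain_joined_split:
  assumes "chain_joined \<Omega> ls z w" and "sum_list ls = s + t" and "s \<ge> 0" and "t \<ge> 0"
  shows "\<exists>ks ms u. chain_joined \<Omega> ks z u \<and> chain_joined \<Omega> ms u w \<and> sum_list ks = s \<and> sum_list ms = t"
  using assms
proof (induction ls arbitrary: z s)
  case Nil
  then show ?case by (intro exI[of _ "[]"]) auto
next
  case (Cons l ls)
  then obtain u where u: "disc_joined \<Omega> l z u" "chain_joined \<Omega> ls u w" by auto
  show ?case
  proof (cases "s \<le> l")
    case True
    obtain v where v: "disc_joined \<Omega> s z v" "disc_joined \<Omega> (l - s) v u"
      using disc_joined_split[of \<Omega> s "l - s" z u] u True Cons.prems by auto
    have "chain_joined \<Omega> [s] z v" "chain_joined \<Omega> ((l - s) # ls) v w"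
      using u v disc_joined_mem by auto
    then show ?thesis using Cons.prems by (intro exI[of _ "[s]"] exI[of _ "(l - s) # ls"]) auto
  next
    case False
    obtain ks ms v where v: "chain_joined \<Omega> ks u v" "chain_joined \<Omega> ms v w"
      "sum_list ks = s - l" "sum_list ms = t"
      using Cons.IH[OF u(2), of "s - l"] Cons.prems False by auto
    then show ?thesis using u by (intro exI[of _ "l # ks"] exI[of _ ms]) auto
  qed
qed

text \<open>Chains of equal total length are compared link by link. When the first links differ in length, the
  longer one is cut so that they agree; this uses up at least one link, which gives the induction.\<close>

lemma chain_joined_convex:
  assumes "convex \<Omega>" and ab: "0 \<le> a" "0 \<le> b" "a + b = 1"
    and "chain_joined \<Omega> ls z w" and "chain_joined \<Omega> ls' z' w'" and "sum_list ls = sum_list ls'"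
  shows "\<exists>ms. chain_joined \<Omega> ms (a *\<^sub>R z + b *\<^sub>R z') (a *\<^sub>R w + b *\<^sub>R w') \<and>
    sum_list ms = sum_list ls"
  using assms(5-)
proof (induction "length ls + length ls'" arbitrary: ls ls' z z' rule: less_induct)
  case less
  have mem: "z \<in> \<Omega>" "z' \<in> \<Omega>" using less.prems chain_joined_mem by auto
  show ?case
  proof (cases "ls = [] \<or> ls' = []")
    case True
    then have s: "sum_list ls = 0" "sum_list ls' = 0" using less.prems by auto
    then have "z = w" "z' = w'" using less.prems chain_joined_sum_0 by blast+
    then show ?thesis using s mem ab assms(1) by (intro exI[of _ "[]"]) (auto intro!: convexD)
  next
    case False
    then obtain l ks l' ks' where ls: "ls = l # ks" "ls' = l' # ks'" by (auto simp: neq_Nil_conv)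
    obtain u where u: "disc_joined \<Omega> l z u" "chain_joined \<Omega> ks u w" using less.prems ls by auto
    obtain u' where u': "disc_joined \<Omega> l' z' u'" "chain_joined \<Omega> ks' u' w'"
      using less.prems ls by auto
    have nn: "l \<ge> 0" "l' \<ge> 0" using u u' by (auto simp: disc_joined_def)
    define c where "c = min l l'"
    obtain v where v: "disc_joined \<Omega> c z v" "disc_joined \<Omega> (l - c) v u"
      using disc_joined_split[of \<Omega> c "l - c" z u] u nn by (auto simp: c_def)
    obtain v' where v': "disc_joined \<Omega> c z' v'" "disc_joined \<Omega> (l' - c) v' u'"
      using disc_joined_split[of \<Omega> c "l' - c" z' u'] u' nn by (auto simp: c_def)
    define ms where "ms = (if l = c then ks else (l - c) # ks)"
    define ms' where "ms' = (if l' = c then ks' else (l' - c) # ks')"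
    have m: "chain_joined \<Omega> ms v w" "chain_joined \<Omega> ms' v' w'"
      using u u' v v' disc_joined_0[of \<Omega> v u] disc_joined_0[of \<Omega> v' u'] by (auto simp: ms_def ms'_def)
    have sm: "sum_list ms = sum_list ls - c" "sum_list ms' = sum_list ls' - c"
      by (auto simp: ms_def ms'_def ls)
    have "length ms + length ms' < length ls + length ls'"
      by (auto simp: ms_def ms'_def ls c_def)
    from less.hyps[OF this m] obtain ns where
      ns: "chain_joined \<Omega> ns (a *\<^sub>R v + b *\<^sub>R v') (a *\<^sub>R w + b *\<^sub>R w')" "sum_list ns = sum_list ms"
      using sm less.prems by auto
    have "chain_joined \<Omega> (c # ns) (a *\<^sub>R z + b *\<^sub>R z') (a *\<^sub>R w + b *\<^sub>R w')"
      using ns disc_joined_convex[OF assms(1) v(1) v'(1) ab] by auto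
    then show ?thesis using ns sm by (intro exI[of _ "c # ns"]) auto
  qed
qed

lemma chain_joined_iff_points:
  "chain_joined \<Omega> ls z w \<longleftrightarrow> w \<in> \<Omega> \<and>
     (\<exists>u. u 0 = z \<and> u (length ls) = w \<and> (\<forall>j<length ls. disc_joined \<Omega> (ls ! j) (u j) (u (Suc j))))"
proof (induction ls arbitrary: z)
  case Nil
  then show ?case by (auto intro: exI[of _ "\<lambda>_. w"])
next
  case (Cons l ls)
  show ?case
  proof
    assume "chain_joined \<Omega> (l # ls) z w"
    then obtain x u where x: "disc_joined \<Omega> l z x" "w \<in> \<Omega>" and u: "u 0 = x" "u (length ls) = w"
      "\<forall>j<length ls. disc_joined \<Omega> (ls ! j) (u j) (u (Suc j))"
      using Cons.IH by auto
    show "w \<in> \<Omega> \<and> (\<exists>u. u 0 = z \<and> u (length (l # ls)) = w \<and>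
        (\<forall>j<length (l # ls). disc_joined \<Omega> ((l # ls) ! j) (u j) (u (Suc j))))"
      using x u by (intro conjI exI[of _ "case_nat z u"]) (auto simp: less_Suc_eq_0_disj)
  next
    assume "w \<in> \<Omega> \<and> (\<exists>u. u 0 = z \<and> u (length (l # ls)) = w \<and>
        (\<forall>j<length (l # ls). disc_joined \<Omega> ((l # ls) ! j) (u j) (u (Suc j))))"
    then obtain u where w: "w \<in> \<Omega>" and u: "u 0 = z" "u (Suc (length ls)) = w"
        "\<forall>j<Suc (length ls). disc_joined \<Omega> ((l # ls) ! j) (u j) (u (Suc j))" by auto
    have "disc_joined \<Omega> l z (u 1)" using u(1) u(3)[rule_format, of 0] by simp
    moreover have "\<forall>j<length ls. disc_joined \<Omega> (ls ! j) (u (Suc j)) (u (Suc (Suc j)))"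
      using u(3) by force
    then have "chain_joined \<Omega> ls (u 1) w"
      unfolding Cons.IH using w u by (intro conjI exI[of _ "\<lambda>j. u (Suc j)"]) auto
    ultimately show "chain_joined \<Omega> (l # ls) z w" by auto
  qed
qed

lemma kobayashi_dist_eq_Inf_chain:
  "kobayashi_dist \<Omega> z w = Inf {sum_list ls | ls. chain_joined \<Omega> ls z w}"
proof -
  have "{(\<Sum>j<m. poincare_dist (a j) (b j)) | m a b.
     m > 0 \<and> (\<forall>j<m. a j \<in> ball 0 1 \<and> b j \<in> ball 0 1) \<and>
     (\<exists>u \<phi>. u 0 = z \<and> u m = w \<and>
        (\<forall>j<m. holomorphic_disc \<Omega> (\<phi> j) \<and> \<phi> j (a j) = u j \<and> \<phi> j (b j) = u (Suc j)))}
     = {sum_list ls | ls. chain_joined \<Omega> ls z w}" (is "?A = ?B")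
  proof (intro equalityI subsetI)
    fix s assume "s \<in> ?A"
    then obtain m a b u \<phi> where s: "s = (\<Sum>j<m. poincare_dist (a j) (b j))" and m: "m > 0"
      and ab: "\<forall>j<m. a j \<in> ball 0 1 \<and> b j \<in> ball 0 1" and u: "u 0 = z" "u m = w"
      and \<phi>: "\<forall>j<m. holomorphic_disc \<Omega> (\<phi> j) \<and> \<phi> j (a j) = u j \<and> \<phi> j (b j) = u (Suc j)"
      by blast
    have d: "disc_joined \<Omega> (poincare_dist (a j) (b j)) (u j) (u (Suc j))" if "j < m" for j
      using disc_joined_poincare_dist[of \<Omega> "\<phi> j" "a j" "b j"] ab \<phi> that by auto
    have "w \<in> \<Omega>" using disc_joined_mem(2)[OF d[of "m - 1"]] m u by simp
    with d u have "chain_joined \<Omega> (map (\<lambda>j. poincare_dist (a j) (b j)) [0..<m]) z w"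
      unfolding chain_joined_iff_points by (intro conjI exI[of _ u]) auto
    moreover have "sum_list (map (\<lambda>j. poincare_dist (a j) (b j)) [0..<m]) = s"
      by (simp add: s interv_sum_list_conv_sum_set_nat atLeast0LessThan)
    ultimately show "s \<in> ?B" by blast
  next
    fix s assume "s \<in> ?B"
    then obtain ls where s: "s = sum_list ls" and "chain_joined \<Omega> ls z w" by auto
    \<comment> \<open>A link of length \<open>0\<close> makes the chain nonempty, as the definition of the distance requires.\<close>
    define ls' where "ls' = 0 # ls"
    have s': "s = sum_list ls'" by (simp add: s ls'_def)
    have "chain_joined \<Omega> ls' z w"
      using \<open>chain_joined \<Omega> ls z w\<close> chain_joined_mem[of \<Omega> ls z w]
      by (auto simp: ls'_def intro!: exI[of _ z] disc_joined_refl)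
    then obtain u where u: "u 0 = z" "u (length ls') = w"
      "\<And>j. j < length ls' \<Longrightarrow> disc_joined \<Omega> (ls' ! j) (u j) (u (Suc j))"
      unfolding chain_joined_iff_points by auto
    then have "\<forall>j\<in>{..<length ls'}. \<exists>\<phi>. holomorphic_disc \<Omega> \<phi> \<and> \<phi> (of_real (tanh (ls' ! j))) = u j \<and> \<phi> 0 = u (Suc j)"
      using disc_joined_sym[OF u(3)] unfolding disc_joined_def by blast
    from bchoice[OF this] obtain \<phi> where \<phi>: "\<forall>j\<in>{..<length ls'}. holomorphic_disc \<Omega> (\<phi> j) \<and> \<phi> j (of_real (tanh (ls' ! j))) = u j \<and> \<phi> j 0 = u (Suc j)"
      by blast
    have "s = (\<Sum>j<length ls'. poincare_dist (of_real (tanh (ls' ! j))) 0)"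
      unfolding s' sum_list_sum_nth atLeast0LessThan
    proof (intro sum.cong refl)
      fix j assume "j \<in> {..<length ls'}"
      then have "ls' ! j \<ge> 0" using u(3)[of j] by (simp add: disc_joined_def)
      then show "ls' ! j = poincare_dist (of_real (tanh (ls' ! j))) 0"
        using poincare_dist_tanh(2)[of 0] by simp
    qed
    moreover have "length ls' > 0" by (simp add: ls'_def)
    ultimately show "s \<in> ?A"
      using u(1,2) \<phi> tanh_in_ball centre_in_ball[of 0 1]
      by (intro CollectI exI[of _ "length ls'"] exI[of _ "\<lambda>j. of_real (tanh (ls' ! j))"]
          exI[of _ "\<lambda>_. 0"] exI[of _ u] exI[of _ \<phi>] conjI) simp_all
  qed
  then show ?thesis by (simp add: kobayashi_dist_def)
qed

section \<open>The Kobayashi distance\<close>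

lemma kobayashi_dist_le:
  assumes "chain_joined \<Omega> ls z w"
  shows "kobayashi_dist \<Omega> z w \<le> sum_list ls"
  unfolding kobayashi_dist_eq_Inf_chain
proof (rule cInf_lower)
  show "bdd_below {sum_list ls |ls. chain_joined \<Omega> ls z w}"
    by (rule bdd_belowI[of _ 0]) (auto dest: chain_joined_nonneg)
qed (use assms in blast)

lemma connected_by_chain:
  assumes "open \<Omega>" and "connected \<Omega>" and "z \<in> \<Omega>" and "w \<in> \<Omega>"
  shows "\<exists>ls. chain_joined \<Omega> ls z w"
proof (rule connected_equivalence_relation[OF assms(2,3,4)])
  show "\<exists>ls. chain_joined \<Omega> ls y x" if "\<exists>ls. chain_joined \<Omega> ls x y" for x y
    using that chain_joined_rev by blast
  show "\<exists>ls. chain_joined \<Omega> ls x v" if "\<exists>ls. chain_joined \<Omega> ls x y" "\<exists>ls. chain_joined \<Omega> ls y v" for x y v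
    using that chain_joined_append by blast
  show "\<exists>T. openin (top_of_set \<Omega>) T \<and> x \<in> T \<and> (\<forall>v\<in>T. \<exists>ls. chain_joined \<Omega> ls x v)" if x: "x \<in> \<Omega>" for x
  proof -
    obtain r where r: "r > 0" "ball x r \<subseteq> \<Omega>" using assms(1) x openE by blast
    have "\<exists>ls. chain_joined \<Omega> ls x v" if "v \<in> ball x r" for v
      using that disc_joined_ball[OF r(2), of v] r(2)
      by (intro exI[of _ "[artanh (dist x v / r)]"]) auto
    then show ?thesis using r by (intro exI[of _ "ball x r"]) (auto intro: open_subset)
  qed
qed

text \<open>A chain may be lengthened to any prescribed total by a constant disc. Having the exact length
  lets two chains be combined and one chain be cut at a given length.\<close>

lemma chain_of_length:
  assumes "open \<Omega>" and "connected \<Omega>" and "z \<in> \<Omega>" and "w \<in> \<Omega>" and "kobayashi_dist \<Omega> z w < L"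
  obtains ls where "chain_joined \<Omega> ls z w" and "sum_list ls = L"
proof -
  have "{sum_list ls |ls. chain_joined \<Omega> ls z w} \<noteq> {}"
    using connected_by_chain[OF assms(1-4)] by blast
  then obtain ls where ls: "chain_joined \<Omega> ls z w" "sum_list ls < L"
    using cInf_lessD[of "{sum_list ls |ls. chain_joined \<Omega> ls z w}" L] assms(5)
    unfolding kobayashi_dist_eq_Inf_chain by auto
  have "chain_joined \<Omega> ((L - sum_list ls) # ls) z w"
    using ls assms(3) by (auto intro!: exI[of _ z] disc_joined_refl)
  then show ?thesis by (rule that) simp
qed

lemma kobayashi_dist_nonneg:
  assumes "open \<Omega>" and "connected \<Omega>" and "z \<in> \<Omega>" and "w \<in> \<Omega>"
  shows "kobayashi_dist \<Omega> z w \<ge> 0"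
  unfolding kobayashi_dist_eq_Inf_chain
  by (rule cInf_greatest) (use connected_by_chain[OF assms] chain_joined_nonneg in auto)

lemma kobayashi_dist_refl: "open \<Omega> \<Longrightarrow> connected \<Omega> \<Longrightarrow> z \<in> \<Omega> \<Longrightarrow> kobayashi_dist \<Omega> z z = 0"
  using kobayashi_dist_le[of \<Omega> "[]" z z] kobayashi_dist_nonneg[of \<Omega> z z] by simp

lemma kobayashi_dist_sym: "kobayashi_dist \<Omega> z w = kobayashi_dist \<Omega> w z"
proof -
  have "{sum_list ls |ls. chain_joined \<Omega> ls z w} = {sum_list ls |ls. chain_joined \<Omega> ls w z}"
    by (metis chain_joined_rev sum_list_rev)
  then show ?thesis by (simp add: kobayashi_dist_eq_Inf_chain)
qed

lemma kobayashi_dist_triangle: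
  assumes "open \<Omega>" and "connected \<Omega>" and "z \<in> \<Omega>" and "u \<in> \<Omega>" and "w \<in> \<Omega>"
  shows "kobayashi_dist \<Omega> z w \<le> kobayashi_dist \<Omega> z u + kobayashi_dist \<Omega> u w"
proof (rule field_le_epsilon)
  fix e :: real assume e: "e > 0"
  obtain ks where ks: "chain_joined \<Omega> ks z u" "sum_list ks = kobayashi_dist \<Omega> z u + e / 2"
    using chain_of_length[OF assms(1-4), of "kobayashi_dist \<Omega> z u + e / 2"] e by auto
  obtain ms where ms: "chain_joined \<Omega> ms u w" "sum_list ms = kobayashi_dist \<Omega> u w + e / 2"
    using chain_of_length[OF assms(1,2,4,5), of "kobayashi_dist \<Omega> u w + e / 2"] e by auto
  show "kobayashi_dist \<Omega> z w \<le> kobayashi_dist \<Omega> z u + kobayashi_dist \<Omega> u w + e"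
    using kobayashi_dist_le[OF chain_joined_append[OF ks(1) ms(1)]] ks ms by simp
qed

text \<open>The length space property, up to an arbitrarily small error, which the strict inequality in the
  hypothesis absorbs.\<close>

lemma kobayashi_dist_split:
  assumes "open \<Omega>" and "connected \<Omega>" and "z \<in> \<Omega>" and "w \<in> \<Omega>"
    and "kobayashi_dist \<Omega> z w < s + t" and "s \<ge> 0" and "t \<ge> 0"
  shows "\<exists>u\<in>\<Omega>. kobayashi_dist \<Omega> z u \<le> s \<and> kobayashi_dist \<Omega> u w \<le> t"
proof -
  obtain ls where "chain_joined \<Omega> ls z w" "sum_list ls = s + t"
    using chain_of_length[OF assms(1-5)] .
  then obtain ks ms u where "chain_joined \<Omega> ks z u" "chain_joined \<Omega> ms u w" "sum_list ks = s" "sum_list ms = t"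
    using chain_joined_split assms(6,7) by metis
  then show ?thesis using kobayashi_dist_le chain_joined_mem by metis
qed

lemma kobayashi_dist_convex:
  assumes "open \<Omega>" and "convex \<Omega>" and mem: "z \<in> \<Omega>" "z' \<in> \<Omega>" "w \<in> \<Omega>" "w' \<in> \<Omega>"
    and L: "kobayashi_dist \<Omega> z w \<le> L" "kobayashi_dist \<Omega> z' w' \<le> L"
    and ab: "0 \<le> a" "0 \<le> b" "a + b = 1"
  shows "kobayashi_dist \<Omega> (a *\<^sub>R z + b *\<^sub>R z') (a *\<^sub>R w + b *\<^sub>R w') \<le> L"
proof (rule field_le_epsilon)
  fix e :: real assume e: "e > 0"
  note conn = convex_connected[OF assms(2)]
  obtain ls where ls: "chain_joined \<Omega> ls z w" "sum_list ls = L + e"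
    using chain_of_length[OF assms(1) conn mem(1,3), of "L + e"] e L by auto
  obtain ls' where ls': "chain_joined \<Omega> ls' z' w'" "sum_list ls' = L + e"
    using chain_of_length[OF assms(1) conn mem(2,4), of "L + e"] e L by auto
  show "kobayashi_dist \<Omega> (a *\<^sub>R z + b *\<^sub>R z') (a *\<^sub>R w + b *\<^sub>R w') \<le> L + e"
    using chain_joined_convex[OF assms(2) ab ls(1) ls'(1)] ls(2) ls'(2) kobayashi_dist_le by metis
qed

lemma kobayashi_dist_small:
  assumes "open \<Omega>" and "z \<in> \<Omega>" and "e > 0"
  shows "\<exists>d>0. \<forall>w. dist z w < d \<longrightarrow> w \<in> \<Omega> \<and> kobayashi_dist \<Omega> z w < e"
proof -
  obtain r where r: "r > 0" "ball z r \<subseteq> \<Omega>" using assms openE by blast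
  have "isCont artanh (0::real)" by (intro isCont_artanh) auto
  then obtain d where d: "d > 0" "\<And>x::real. \<bar>x\<bar> < d \<Longrightarrow> \<bar>artanh x\<bar> < e"
    using assms(3) by (auto simp: continuous_at_eps_delta dist_real_def)
  have "w \<in> \<Omega> \<and> kobayashi_dist \<Omega> z w < e" if w: "dist z w < min r (d * r)" for w
  proof -
    have ch: "chain_joined \<Omega> [artanh (dist z w / r)] z w"
      using disc_joined_ball[OF r(2), of w] disc_joined_mem(2) w by auto
    have "w \<in> \<Omega>" "kobayashi_dist \<Omega> z w \<le> artanh (dist z w / r)"
      using chain_joined_mem[OF ch] kobayashi_dist_le[OF ch] by simp_all
    moreover have "\<bar>dist z w / r\<bar> < d" using w r by (simp add: divide_simps)
    then have "\<bar>artanh (dist z w / r)\<bar> < e" by (rule d(2))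
    ultimately show ?thesis by auto
  qed
  then show ?thesis using r d by (intro exI[of _ "min r (d * r)"]) auto
qed

text \<open>The chain rule: a complex homogeneous derivative turns \<open>h *s v\<close> into \<open>h *s D v\<close>, so the components
  of the composition are complex differentiable.\<close>

lemma holomorphic_disc_map:
  assumes g: "holomorphic_map_on g \<Omega>" "g \<in> \<Omega> \<rightarrow> \<Omega>'" and \<phi>: "holomorphic_disc \<Omega> \<phi>"
  shows "holomorphic_disc \<Omega>' (g \<circ> \<phi>)"
  unfolding holomorphic_disc_def
proof (intro conjI allI)
  fix i
  show "(\<lambda>\<zeta>. (g \<circ> \<phi>) \<zeta> $ i) holomorphic_on ball 0 1"
    unfolding holomorphic_on_def
  proof
    fix \<zeta> :: complex assume \<zeta>: "\<zeta> \<in> ball 0 1"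
    have "\<forall>j. \<exists>d. ((\<lambda>\<zeta>. \<phi> \<zeta> $ j) has_field_derivative d) (at \<zeta> within ball 0 1)"
      using \<phi> \<zeta> by (auto simp: holomorphic_disc_def holomorphic_on_def field_differentiable_def)
    then obtain d where d: "\<And>j. ((\<lambda>\<zeta>. \<phi> \<zeta> $ j) has_field_derivative d j) (at \<zeta> within ball 0 1)"
      by metis
    define v where "v = (\<chi> j. d j)"
    have 1: "(\<phi> has_derivative (\<lambda>h. h *s v)) (at \<zeta> within ball 0 1)"
      unfolding has_derivative_componentwise_within[of \<phi>]
    proof
      fix b :: "complex ^ 'a" assume "b \<in> Basis"
      then obtain j u where b: "b = axis j u" by (auto simp: Basis_vec_def)
      have "((\<lambda>x. \<phi> x $ j) has_derivative (\<lambda>h. d j * h)) (at \<zeta> within ball 0 1)"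
        using d[of j] by (simp add: has_field_derivative_def)
      then have "((\<lambda>x. \<phi> x $ j \<bullet> u) has_derivative (\<lambda>h. (d j * h) \<bullet> u)) (at \<zeta> within ball 0 1)"
        by (rule has_derivative_inner_left)
      then show "((\<lambda>x. \<phi> x \<bullet> b) has_derivative (\<lambda>x. (x *s v) \<bullet> b)) (at \<zeta> within ball 0 1)"
        by (simp add: b inner_axis v_def mult.commute)
    qed
    have im: "\<phi> ` ball 0 1 \<subseteq> \<Omega>" using \<phi> by (simp add: holomorphic_disc_def)
    obtain D where D: "(g has_derivative D) (at (\<phi> \<zeta>) within \<Omega>)" "\<And>c v. D (c *s v) = c *s D v"
      using g \<phi> \<zeta> im unfolding holomorphic_map_on_def by blast
    have "(g has_derivative D) (at (\<phi> \<zeta>) within \<phi> ` ball 0 1)"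
      using has_derivative_subset[OF D(1) im] .
    then have "((g \<circ> \<phi>) has_derivative (D \<circ> (\<lambda>h. h *s v))) (at \<zeta> within ball 0 1)"
      by (rule diff_chain_within[OF 1])
    then have "((\<lambda>x. (g \<circ> \<phi>) x $ i) has_derivative (\<lambda>h. (D \<circ> (\<lambda>h. h *s v)) h $ i)) (at \<zeta> within ball 0 1)"
      by (rule bounded_linear.has_derivative[OF bounded_linear_vec_nth])
    moreover have "(\<lambda>h. (D \<circ> (\<lambda>h. h *s v)) h $ i) = (*) (D v $ i)"
      by (auto simp: D(2))
    ultimately show "(\<lambda>\<zeta>. (g \<circ> \<phi>) \<zeta> $ i) field_differentiable at \<zeta> within ball 0 1"
      unfolding field_differentiable_def has_field_derivative_def by metis
  qed
  show "(g \<circ> \<phi>) ` ball 0 1 \<subseteq> \<Omega>'"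
    using g(2) \<phi> by (auto simp: holomorphic_disc_def)
qed

lemma chain_joined_map:
  assumes "holomorphic_map_on g \<Omega>" and "g \<in> \<Omega> \<rightarrow> \<Omega>'"
  shows "chain_joined \<Omega> ls z w \<Longrightarrow> chain_joined \<Omega>' ls (g z) (g w)"
proof (induction ls arbitrary: z)
  case Nil
  then show ?case using assms by auto
next
  case (Cons l ls)
  then obtain u \<phi> where u: "chain_joined \<Omega> ls u w" "l \<ge> 0" "holomorphic_disc \<Omega> \<phi>" "\<phi> 0 = z" "\<phi> (of_real (tanh l)) = u"
    by (auto simp: disc_joined_def)
  then have "disc_joined \<Omega>' l (g z) (g u)"
    using holomorphic_disc_map[OF assms u(3)] by (auto simp: disc_joined_def)
  then show ?case using Cons.IH[OF u(1)] by auto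
qed

lemma kobayashi_dist_nonexpansive:
  assumes "open \<Omega>" and "connected \<Omega>" and "holomorphic_map_on g \<Omega>" and "g \<in> \<Omega> \<rightarrow> \<Omega>'"
    and "z \<in> \<Omega>" and "w \<in> \<Omega>"
  shows "kobayashi_dist \<Omega>' (g z) (g w) \<le> kobayashi_dist \<Omega> z w"
proof (rule field_le_epsilon)
  fix e :: real assume "e > 0"
  then obtain ls where "chain_joined \<Omega> ls z w" "sum_list ls = kobayashi_dist \<Omega> z w + e"
    using chain_of_length[OF assms(1,2,5,6), of "kobayashi_dist \<Omega> z w + e"] by auto
  then show "kobayashi_dist \<Omega>' (g z) (g w) \<le> kobayashi_dist \<Omega> z w + e"
    using kobayashi_dist_le[OF chain_joined_map[OF assms(3,4)]] by metis
qed

section \<open>Properness of the Kobayashi distance on convex domains\<close>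

text \<open>The Harnack inequality in the exact form \<open>(1 - r) / (1 + r) = exp (- 2 * l)\<close> for \<open>r = tanh l\<close>. It
  is the Schwarz lemma for the composition of \<open>g\<close> with the Cayley map of the right half-plane that
  sends \<open>g 0\<close> to \<open>0\<close>.\<close>

lemma Harnack_disc:
  assumes g: "g holomorphic_on ball 0 1" and pos: "\<And>\<zeta>. \<zeta> \<in> ball 0 1 \<Longrightarrow> Re (g \<zeta>) > 0" and l: "l \<ge> 0"
  shows "exp (- 2 * l) * Re (g 0) \<le> Re (g (of_real (tanh l)))"
proof -
  define G where "G \<zeta> = (g \<zeta> - g 0) / (g \<zeta> + cnj (g 0))" for \<zeta>
  have p0: "Re (g 0) > 0" by (simp add: pos)
  have nz: "g \<zeta> + cnj (g 0) \<noteq> 0" if "\<zeta> \<in> ball 0 1" for \<zeta>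
  proof -
    have "Re (g \<zeta> + cnj (g 0)) > 0" using pos[OF that] p0 by simp
    then show ?thesis by (metis less_irrefl zero_complex.sel(1))
  qed
  have "G holomorphic_on ball 0 1"
    unfolding G_def[abs_def] using g nz by (auto intro!: holomorphic_intros)
  moreover have "G 0 = 0" by (simp add: G_def)
  moreover have "cmod (G \<zeta>) < 1" if "cmod \<zeta> < 1" for \<zeta>
  proof -
    have "Re (g \<zeta>) > 0" using pos that by simp
    then have "\<bar>Re (g \<zeta>) - Re (g 0)\<bar> < \<bar>Re (g \<zeta>) + Re (g 0)\<bar>" using p0 by linarith
    then have "(Re (g \<zeta>) - Re (g 0))\<^sup>2 < (Re (g \<zeta>) + Re (g 0))\<^sup>2"
      by (metis abs_le_square_iff not_le)
    then have "cmod (g \<zeta> - g 0) < cmod (g \<zeta> + cnj (g 0))" by (simp add: cmod_def)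
    then show ?thesis using nz[of \<zeta>] that by (simp add: G_def norm_divide)
  qed
  moreover define r where "r = tanh l"
  have r: "0 \<le> r" "r < 1" using l by (simp_all add: r_def tanh_real_lt_1)
  ultimately have "cmod (G (of_real r)) \<le> r"
    using Schwarz_Lemma(1)[of G "of_real r"] by simp
  then have le: "cmod (g r - g 0) \<le> r * cmod (g r + cnj (g 0))"
    using nz[of r] r by (simp add: G_def norm_divide divide_simps)
  have pr: "Re (g r) > 0" using pos[of r] r by simp
  \<comment> \<open>Since \<open>r \<le> 1\<close>, the imaginary parts may be dropped from the squared inequality.\<close>
  have "(Re (g r) - Re (g 0))\<^sup>2 + (Im (g r) - Im (g 0))\<^sup>2
      \<le> r\<^sup>2 * ((Re (g r) + Re (g 0))\<^sup>2 + (Im (g r) - Im (g 0))\<^sup>2)"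
    using power_mono[OF le, of 2] by (simp add: cmod_power2 power_mult_distrib)
  moreover have "r\<^sup>2 * (Im (g r) - Im (g 0))\<^sup>2 \<le> (Im (g r) - Im (g 0))\<^sup>2"
    using r by (intro mult_left_le_one_le) (auto simp: power_le_one)
  ultimately have "(Re (g r) - Re (g 0))\<^sup>2 \<le> (r * (Re (g r) + Re (g 0)))\<^sup>2"
    by (simp only: power_mult_distrib distrib_left[of "r\<^sup>2"])
  then have "\<bar>Re (g r) - Re (g 0)\<bar> \<le> r * (Re (g r) + Re (g 0))"
    using r p0 pr by (intro power2_le_imp_le[of "\<bar>Re (g r) - Re (g 0)\<bar>"]) auto
  then have "(1 - r) * Re (g 0) \<le> (1 + r) * Re (g r)" by (simp add: algebra_simps abs_le_iff)
  then have "(1 - r) / (1 + r) * Re (g 0) \<le> Re (g r)" using r by (simp add: divide_le_eq mult.commute)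
  moreover have "exp (- 2 * l) = (1 - r) / (1 + r)"
  proof -
    define E where "E = exp (- 2 * l)"
    have "E > 0" by (simp add: E_def)
    then show ?thesis
      unfolding r_def tanh_real_altdef E_def[symmetric] by (simp add: field_simps)
  qed
  ultimately show ?thesis by (simp only: r_def)
qed

text \<open>A real half-space is the region where a complex linear function has real part less than \<open>c\<close>.
  Along each link the Harnack inequality bounds how fast the distance to its boundary can shrink.\<close>

lemma chain_joined_halfspace:
  assumes "\<And>w. w \<in> \<Omega> \<Longrightarrow> a \<bullet> w < c"
  shows "chain_joined \<Omega> ls z w \<Longrightarrow> exp (- 2 * sum_list ls) * (c - a \<bullet> z) \<le> c - a \<bullet> w"
proof (induction ls arbitrary: z)
  case (Cons l ls)
  then obtain u \<phi> where u: "chain_joined \<Omega> ls u w" "l \<ge> 0" "holomorphic_disc \<Omega> \<phi>" "\<phi> 0 = z" "\<phi> (of_real (tanh l)) = u"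
    by (auto simp: disc_joined_def)
  define g where "g \<zeta> = of_real c - (\<Sum>i\<in>UNIV. cnj (a $ i) * \<phi> \<zeta> $ i)" for \<zeta>
  have re: "Re (g \<zeta>) = c - a \<bullet> \<phi> \<zeta>" for \<zeta>
    by (simp add: g_def inner_vec_def inner_complex_def)
  have "g holomorphic_on ball 0 1"
    unfolding g_def[abs_def] using u(3) by (auto intro!: holomorphic_intros simp: holomorphic_disc_def)
  moreover have "Re (g \<zeta>) > 0" if "\<zeta> \<in> ball 0 1" for \<zeta>
    proof -
      have "\<phi> \<zeta> \<in> \<Omega>" using u(3) that unfolding holomorphic_disc_def by blast
    then show ?thesis using assms by (simp add: re)
  qed
  ultimately have "exp (- 2 * l) * (c - a \<bullet> z) \<le> c - a \<bullet> u"
    using Harnack_disc[of g l] u by (simp add: re)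
  then have "exp (- 2 * sum_list ls) * (exp (- 2 * l) * (c - a \<bullet> z)) \<le> exp (- 2 * sum_list ls) * (c - a \<bullet> u)"
    by simp
  also have "\<dots> \<le> c - a \<bullet> w" by (rule Cons.IH[OF u(1)])
  finally show ?case by (simp add: exp_add[symmetric] mult.assoc[symmetric] distrib_left add.commute)
qed auto

lemma kobayashi_dist_halfspace:
  assumes "open \<Omega>" and "connected \<Omega>" and "\<And>w. w \<in> \<Omega> \<Longrightarrow> a \<bullet> w < c"
    and "z \<in> \<Omega>" and "w \<in> \<Omega>" and "kobayashi_dist \<Omega> z w \<le> r"
  shows "exp (- 2 * (r + 1)) * (c - a \<bullet> z) \<le> c - a \<bullet> w"
proof -
  obtain ls where "chain_joined \<Omega> ls z w" "sum_list ls = r + 1"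
    using chain_of_length[OF assms(1,2,4,5), of "r + 1"] assms(6) by auto
  then show ?thesis using chain_joined_halfspace[of \<Omega> a c] assms(3) by metis
qed

lemma open_convex_supporting_hyperplane:
  fixes S :: "'a::euclidean_space set"
  assumes "open S" and "convex S" and "x \<in> frontier S"
  obtains a where "\<And>y. y \<in> S \<Longrightarrow> a \<bullet> y < a \<bullet> x"
proof -
  have "rel_interior S = S" using assms(1) by (simp add: rel_interior_open)
  moreover have "x \<in> closure S" "x \<notin> S" using assms by (auto simp: frontier_def interior_open)
  ultimately obtain a where "\<And>y. y \<in> S \<Longrightarrow> a \<bullet> x < a \<bullet> y"
    using supporting_hyperplane_relative_frontier[OF assms(2), of x] by metis
  then show ?thesis by (intro that[of "- a"]) auto
qed

text \<open>A sequence in a Kobayashi ball cannot tend to the boundary: by \<open>kobayashi_dist_halfspace\<close> it keeps a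
  fixed distance from the supporting hyperplane at any boundary point.\<close>

lemma compact_kobayashi_cball:
  assumes "open \<Omega>" and "convex \<Omega>" and "bounded \<Omega>" and z: "z \<in> \<Omega>"
  shows "compact {w \<in> \<Omega>. kobayashi_dist \<Omega> z w \<le> r}" (is "compact ?B")
proof -
  note conn = convex_connected[OF assms(2)]
  have "x \<in> ?B" if x: "x \<in> closure ?B" for x
  proof -
    have "x \<in> closure \<Omega>" using x closure_mono[of ?B \<Omega>] by auto
    have xO: "x \<in> \<Omega>"
    proof (rule ccontr)
      assume "x \<notin> \<Omega>"
      with \<open>x \<in> closure \<Omega>\<close> have "x \<in> frontier \<Omega>"
        using assms(1) by (simp add: frontier_def interior_open)
      then obtain a where a: "\<And>y. y \<in> \<Omega> \<Longrightarrow> a \<bullet> y < a \<bullet> x"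
        using open_convex_supporting_hyperplane assms(1,2) by metis
      define \<delta> where "\<delta> = exp (- 2 * (r + 1)) * (a \<bullet> x - a \<bullet> z)"
      have "?B \<subseteq> {w. a \<bullet> w \<le> a \<bullet> x - \<delta>}"
        using kobayashi_dist_halfspace[OF assms(1) conn a z] by (force simp: \<delta>_def)
      then have "closure ?B \<subseteq> {w. a \<bullet> w \<le> a \<bullet> x - \<delta>}"
        by (rule closure_minimal) (rule closed_halfspace_le)
      with x have "\<delta> \<le> 0" by auto
      then show False using a[OF z] by (simp add: \<delta>_def mult_le_0_iff)
    qed
    moreover have "kobayashi_dist \<Omega> z x \<le> r"
    proof (rule field_le_epsilon)
      fix e :: real assume "e > 0"
      from kobayashi_dist_small[OF assms(1) xO this] obtain d where
        d: "d > 0" "\<And>w. dist x w < d \<Longrightarrow> w \<in> \<Omega> \<and> kobayashi_dist \<Omega> x w < e" by blast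
      obtain w where w: "w \<in> ?B" "dist w x < d" using x d(1) unfolding closure_approachable by blast
      then show "kobayashi_dist \<Omega> z x \<le> r + e"
        using kobayashi_dist_triangle[OF assms(1) conn z _ xO, of w] d(2)[of w] kobayashi_dist_sym[of \<Omega> x w]
        by (auto simp: dist_commute)
    qed
    ultimately show ?thesis by simp
  qed
  then have "closed ?B" using closure_subset_eq by blast
  moreover have "bounded ?B" using assms(3) by (rule bounded_subset) auto
  ultimately show ?thesis by (simp add: compact_eq_bounded_closed)
qed

section \<open>Nonexpansive maps and horofunctions of proper spaces\<close>

text \<open>Convergence of a sequence in the space of functions modulo constants, with the representatives
  that vanish at the base point \<open>p\<close>.\<close>

definition tends_to_horofunction ::
  "'a::topological_space set \<Rightarrow> ('a \<Rightarrow> 'a \<Rightarrow> real) \<Rightarrow> 'a \<Rightarrow> (nat \<Rightarrow> 'a) \<Rightarrow> ('a \<Rightarrow> real) \<Rightarrow> bool" where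
  "tends_to_horofunction \<Omega> k p x h \<longleftrightarrow> (\<forall>K. compact K \<and> K \<subseteq> \<Omega> \<longrightarrow>
     uniform_limit K (\<lambda>n z. k (x n) z - k (x n) p) h sequentially)"

lemma tends_to_horofunctionD:
  "tends_to_horofunction \<Omega> k p x h \<Longrightarrow> compact K \<Longrightarrow> K \<subseteq> \<Omega> \<Longrightarrow>
     uniform_limit K (\<lambda>n z. k (x n) z - k (x n) p) h sequentially"
  by (simp add: tends_to_horofunction_def)

text \<open>A pseudometric on a subset of a Euclidean space whose balls are neighbourhoods in the Euclidean
  topology and whose closed balls are compact: the Euclidean topology supplies compactness and
  fixed points, the pseudometric the estimates.\<close>

locale proper_pseudometric =
  fixes \<Omega> :: "'a::euclidean_space set" and k :: "'a \<Rightarrow> 'a \<Rightarrow> real"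
  assumes k_refl: "z \<in> \<Omega> \<Longrightarrow> k z z = 0"
    and k_sym: "z \<in> \<Omega> \<Longrightarrow> w \<in> \<Omega> \<Longrightarrow> k z w = k w z"
    and k_triangle: "z \<in> \<Omega> \<Longrightarrow> u \<in> \<Omega> \<Longrightarrow> w \<in> \<Omega> \<Longrightarrow> k z w \<le> k z u + k u w"
    and k_small: "z \<in> \<Omega> \<Longrightarrow> e > 0 \<Longrightarrow> \<exists>d>0. \<forall>w. dist z w < d \<longrightarrow> w \<in> \<Omega> \<and> k z w < e"
    and k_proper: "z \<in> \<Omega> \<Longrightarrow> compact {w \<in> \<Omega>. k z w \<le> r}"
begin

lemma k_nonneg: "z \<in> \<Omega> \<Longrightarrow> w \<in> \<Omega> \<Longrightarrow> k z w \<ge> 0"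
  using k_triangle[of z w z] k_refl[of z] k_sym[of z w] by simp

lemma k_lipschitz:
  assumes "x \<in> \<Omega>" and "z \<in> \<Omega>" and "w \<in> \<Omega>"
  shows "\<bar>k x z - k x w\<bar> \<le> k z w"
  using k_triangle[of x z w] k_triangle[of x w z] k_sym[of z w] assms by auto

lemma k_lipschitz_continuous_on:
  assumes "\<And>z w. z \<in> \<Omega> \<Longrightarrow> w \<in> \<Omega> \<Longrightarrow> \<bar>g z - g w\<bar> \<le> k z w"
  shows "continuous_on \<Omega> g"
  unfolding continuous_on_iff
proof (intro ballI allI impI)
  fix z and e :: real assume z: "z \<in> \<Omega>" and "e > 0"
  then obtain d where d: "d > 0" "\<And>w. dist z w < d \<Longrightarrow> w \<in> \<Omega> \<and> k z w < e" using k_small by blast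
  have "dist (g w) (g z) < e" if "w \<in> \<Omega>" "dist w z < d" for w
    using assms[OF z that(1)] d(2)[of w] that(2) by (simp add: dist_real_def dist_commute abs_minus_commute)
  then show "\<exists>d>0. \<forall>w\<in>\<Omega>. dist w z < d \<longrightarrow> dist (g w) (g z) < e" using d(1) by blast
qed

lemma k_tendsto_0:
  assumes "(x \<longlongrightarrow> w) F" and "w \<in> \<Omega>"
  shows "((\<lambda>n. k w (x n)) \<longlongrightarrow> 0) F"
proof (rule tendstoI)
  fix e :: real assume "e > 0"
  then obtain d where d: "d > 0" "\<And>v. dist w v < d \<Longrightarrow> v \<in> \<Omega> \<and> k w v < e"
    using k_small assms(2) by blast
  show "\<forall>\<^sub>F n in F. dist (k w (x n)) 0 < e"
    using tendstoD[OF assms(1) d(1)]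
    by eventually_elim (use d(2) k_nonneg assms(2) in \<open>auto simp: dist_commute\<close>)
qed

lemma finite_net:
  assumes "compact K" and "K \<subseteq> \<Omega>" and "A \<subseteq> K" and "e > 0"
  obtains F where "finite F" and "F \<subseteq> A" and "\<And>a. a \<in> A \<Longrightarrow> \<exists>b\<in>F. k b a < e"
proof -
  have "\<forall>z\<in>K. \<exists>d>0. \<forall>w. dist z w < d \<longrightarrow> w \<in> \<Omega> \<and> k z w < e / 2"
    using k_small assms by (meson half_gt_zero subsetD)
  then obtain d where d: "\<And>z. z \<in> K \<Longrightarrow> d z > 0"
    "\<And>z w. z \<in> K \<Longrightarrow> dist z w < d z \<Longrightarrow> w \<in> \<Omega> \<and> k z w < e / 2" by metis
  have "K \<subseteq> (\<Union>z\<in>K. ball z (d z))" using d by force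
  then obtain C where C: "C \<subseteq> K" "finite C" "K \<subseteq> (\<Union>z\<in>C. ball z (d z))"
    using compactE_image[OF assms(1), of K "\<lambda>z. ball z (d z)"] by auto
  define i where "i c = (SOME a. a \<in> A \<inter> ball c (d c))" for c
  define F where "F = i ` {c \<in> C. A \<inter> ball c (d c) \<noteq> {}}"
  have i: "i c \<in> A \<inter> ball c (d c)" if "A \<inter> ball c (d c) \<noteq> {}" for c
    unfolding i_def by (rule someI_ex) (use that in blast)
  show ?thesis
  proof (rule that)
    show "finite F" using C(2) by (simp add: F_def)
    show "F \<subseteq> A" using i by (auto simp: F_def)
    fix a assume a: "a \<in> A"
    then obtain c where c: "c \<in> C" "a \<in> ball c (d c)" using C assms by blast
    then have ne: "A \<inter> ball c (d c) \<noteq> {}" using a by blast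
    have "k c a < e / 2" "k c (i c) < e / 2" "c \<in> \<Omega>" "a \<in> \<Omega>" "i c \<in> \<Omega>"
      using d(2)[of c a] d(2)[of c "i c"] c C i[OF ne] assms by auto
    then have "k (i c) a < e" using k_triangle[of "i c" c a] k_sym[of "i c" c] by auto
    then show "\<exists>b\<in>F. k b a < e" using c ne by (auto simp: F_def)
  qed
qed

lemma bounded_sequence_subconverges:
  assumes "p \<in> \<Omega>" and "\<And>n. x n \<in> \<Omega>" and "\<And>n. k p (x n) \<le> C"
  obtains r l where "strict_mono (r :: nat \<Rightarrow> nat)" and "l \<in> \<Omega>" and "(\<lambda>n. x (r n)) \<longlonglongrightarrow> l"
proof -
  have "seq_compact {w \<in> \<Omega>. k p w \<le> C}" using k_proper[OF assms(1)] compact_imp_seq_compact by blast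
  moreover have "\<forall>n. x n \<in> {w \<in> \<Omega>. k p w \<le> C}" using assms by auto
  ultimately obtain l r where "l \<in> {w \<in> \<Omega>. k p w \<le> C}" "strict_mono r" "(x \<circ> r) \<longlonglongrightarrow> l"
    by (rule seq_compactE)
  then show ?thesis using that by (auto simp: o_def)
qed

context
  fixes f :: "'a \<Rightarrow> 'a"
  assumes f_self_map: "f \<in> \<Omega> \<rightarrow> \<Omega>"
    and f_nonexpansive: "\<forall>z\<in>\<Omega>. \<forall>w\<in>\<Omega>. k (f z) (f w) \<le> k z w"
begin

lemma funpow_mem: "z \<in> \<Omega> \<Longrightarrow> (f ^^ n) z \<in> \<Omega>"
  using f_self_map by (induction n) auto

lemma funpow_nonexpansive: "z \<in> \<Omega> \<Longrightarrow> w \<in> \<Omega> \<Longrightarrow> k ((f ^^ n) z) ((f ^^ n) w) \<le> k z w"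
proof (induction n)
  case (Suc n)
  then show ?case
    using f_nonexpansive funpow_mem[of z n] funpow_mem[of w n] by force
qed auto

lemma funpow_dist_mono:
  assumes "w \<in> \<Omega>"
  shows "k ((f ^^ (a + j)) w) ((f ^^ (b + j)) w) \<le> k ((f ^^ a) w) ((f ^^ b) w)"
proof -
  have "(f ^^ (i + j)) w = (f ^^ j) ((f ^^ i) w)" for i
    by (subst add.commute) (simp add: funpow_add)
  then show ?thesis
    using funpow_nonexpansive[OF funpow_mem[OF assms, of a] funpow_mem[OF assms, of b], of j] by simp
qed

text \<open>Distances along an orbit can only decrease in time. If the starting point is recurrent, then after a
  return time they are almost what they were, so they have not decreased at all.\<close>

lemma recurrent_orbit_isometric:
  assumes w: "w \<in> \<Omega>" and rec: "\<And>e N. e > 0 \<Longrightarrow> \<exists>n\<ge>N. k w ((f ^^ n) w) < e"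
  shows "k ((f ^^ (a + j)) w) ((f ^^ (b + j)) w) = k ((f ^^ a) w) ((f ^^ b) w)"
proof (rule antisym[OF funpow_dist_mono[OF w] field_le_epsilon])
  fix e :: real assume "e > 0"
  then obtain n where n: "n \<ge> j" "k w ((f ^^ n) w) < e / 2" using rec[of "e / 2" j] by auto
  have mem: "(f ^^ m) w \<in> \<Omega>" for m by (rule funpow_mem[OF w])
  have close: "k ((f ^^ m) w) ((f ^^ (m + n)) w) < e / 2" for m
    using funpow_dist_mono[OF w, of 0 m n] n by (simp add: add.commute)
  have "k ((f ^^ (a + n)) w) ((f ^^ (b + n)) w) \<le> k ((f ^^ (a + j)) w) ((f ^^ (b + j)) w)"
    using funpow_dist_mono[OF w, of "a + j" "n - j" "b + j"] n by (simp add: add.assoc)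
  moreover have "k ((f ^^ a) w) ((f ^^ b) w) \<le> k ((f ^^ a) w) ((f ^^ (a + n)) w)
      + k ((f ^^ (a + n)) w) ((f ^^ (b + n)) w) + k ((f ^^ (b + n)) w) ((f ^^ b) w)"
    using k_triangle[OF mem mem mem, of a b "a + n"] k_triangle[OF mem mem mem, of "a + n" b "b + n"] by linarith
  moreover have "k ((f ^^ (b + n)) w) ((f ^^ b) w) < e / 2" using close[of b] k_sym[OF mem mem] by simp
  ultimately show "k ((f ^^ a) w) ((f ^^ b) w) \<le> k ((f ^^ (a + j)) w) ((f ^^ (b + j)) w) + e"
    using close[of a] by linarith
qed

text \<open>Let \<open>S\<close> be the set of return times to the unit ball around \<open>w\<close>. By compactness finitely many times
  \<open>I \<subseteq> S\<close> are such that each orbit point in that ball is within distance \<open>1\<close> of the orbit point at some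
  time in \<open>I\<close>. As the map is isometric along the orbit, subtracting this time from a later return time
  gives a return time again. So going down from a large return time never skips more than
  \<open>L = Max I\<close> steps, and \<open>S\<close> has gaps of length at most \<open>L\<close>.\<close>

lemma recurrent_orbit_bounded:
  assumes w: "w \<in> \<Omega>" and rec: "\<And>e N. e > 0 \<Longrightarrow> \<exists>n\<ge>N. k w ((f ^^ n) w) < e"
  shows "\<exists>B. \<forall>n. k w ((f ^^ n) w) \<le> B"
proof -
  have mem: "(f ^^ m) w \<in> \<Omega>" for m by (rule funpow_mem[OF w])
  have iso: "k ((f ^^ i) w) ((f ^^ n) w) = k w ((f ^^ (n - i)) w)" if "i \<le> n" for i n
    using recurrent_orbit_isometric[OF w rec, of 0 i "n - i"] that by simp
  define S where "S = {n. n \<ge> 1 \<and> k w ((f ^^ n) w) \<le> 1}"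
  obtain F where F: "finite F" "F \<subseteq> (\<lambda>n. (f ^^ n) w) ` S"
      "\<And>a. a \<in> (\<lambda>n. (f ^^ n) w) ` S \<Longrightarrow> \<exists>b\<in>F. k b a < 1"
    using finite_net[OF k_proper[OF w, of 1], of "(\<lambda>n. (f ^^ n) w) ` S" 1] mem by (auto simp: S_def)
  obtain I where I: "finite I" "I \<subseteq> S" "F = (\<lambda>n. (f ^^ n) w) ` I"
    using finite_subset_image[OF F(1,2)] by blast
  define L where "L = Max (insert 0 I)"
  have L: "i \<le> L" if "i \<in> I" for i using that I by (simp add: L_def)
  have gap: "\<exists>n\<in>S. m \<le> n \<and> n \<le> m + L" for m
  proof -
    have ex: "\<exists>n. n \<in> S \<and> m \<le> n"
      using rec[of 1 "max 1 m"] by (force simp: S_def)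
    define n where "n = (LEAST n. n \<in> S \<and> m \<le> n)"
    have n: "n \<in> S" "m \<le> n" using LeastI_ex[OF ex] by (auto simp: n_def)
    have "n \<le> m + L"
    proof (rule ccontr)
      assume c: "\<not> n \<le> m + L"
      obtain i where i: "i \<in> I" "k ((f ^^ i) w) ((f ^^ n) w) < 1" using F(3) n I by blast
      have "i \<le> L" "i \<ge> 1" using i L I by (auto simp: S_def)
      with c i iso[of i n] have "n - i \<in> S \<and> m \<le> n - i" by (auto simp: S_def)
      then have "n \<le> n - i" unfolding n_def by (rule Least_le)
      then show False using \<open>i \<ge> 1\<close> n(1) by (auto simp: S_def)
    qed
    then show ?thesis using n by blast
  qed
  have "k w ((f ^^ m) w) \<le> 1 + Max ((\<lambda>j. k w ((f ^^ j) w)) ` {..L})" for m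
  proof -
    obtain n where n: "n \<in> S" "m \<le> n" "n \<le> m + L" using gap by blast
    have "k w ((f ^^ m) w) \<le> k w ((f ^^ n) w) + k ((f ^^ m) w) ((f ^^ n) w)"
      using k_triangle[OF w mem mem, of m n] k_sym[OF mem mem, of m n] by simp
    moreover have "k ((f ^^ m) w) ((f ^^ n) w) \<le> Max ((\<lambda>j. k w ((f ^^ j) w)) ` {..L})"
      using iso[OF n(2)] n by (auto intro!: Max_ge)
    ultimately show ?thesis using n(1) by (simp add: S_def)
  qed
  then show ?thesis by blast
qed

text \<open>A limit point \<open>w\<close> of the bounded subsequence is recurrent, because the differences of the times at
  which the orbit of \<open>z\<close> is close to \<open>w\<close> are return times of \<open>w\<close>. So the orbit of \<open>w\<close> is bounded,
  and the orbit of \<open>z\<close> stays at bounded distance from it.\<close>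

theorem Calka_bounded_orbit:
  assumes p: "p \<in> \<Omega>" and z: "z \<in> \<Omega>" and inf: "infinite {n. k p ((f ^^ n) z) \<le> C}"
  shows "\<exists>B. \<forall>n. k p ((f ^^ n) z) \<le> B"
proof -
  obtain s :: "nat \<Rightarrow> nat" where s: "strict_mono s" "\<And>n. k p ((f ^^ s n) z) \<le> C"
    using infinite_enumerate[OF inf] by auto
  obtain r w where r: "strict_mono (r :: nat \<Rightarrow> nat)" "w \<in> \<Omega>" "(\<lambda>n. (f ^^ s (r n)) z) \<longlonglongrightarrow> w"
    using bounded_sequence_subconverges[OF p, of "\<lambda>n. (f ^^ s n) z" C] s funpow_mem[OF z] by blast
  define t where "t n = s (r n)" for n
  have t: "strict_mono t" using s(1) r(1) by (auto simp: t_def strict_mono_def)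
  have mem: "(f ^^ m) z \<in> \<Omega>" "(f ^^ m) w \<in> \<Omega>" for m using funpow_mem z r(2) by auto
  have lim: "(\<lambda>n. k w ((f ^^ t n) z)) \<longlonglongrightarrow> 0"
    using k_tendsto_0[OF r(3,2)] by (simp add: t_def)
  have rec: "\<exists>n\<ge>N. k w ((f ^^ n) w) < e" if e: "e > 0" for e N
  proof -
    obtain M where M: "\<And>m. m \<ge> M \<Longrightarrow> k w ((f ^^ t m) z) < e / 2"
      using order_tendstoD(2)[OF lim, of "e / 2"] e by (auto simp: eventually_sequentially)
    have "t M + j \<le> t (M + j)" for j
    proof (induction j)
      case (Suc j)
      then show ?case using strict_monoD[OF t, of "M + j" "M + Suc j"] by simp
    qed auto
    then have tN: "t M + N \<le> t (M + N)" .
    define n where "n = t (M + N) - t M"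
    have "n \<ge> N" and n: "t (M + N) = n + t M" using tN by (auto simp: n_def)
    have "k ((f ^^ n) w) ((f ^^ t (M + N)) z) \<le> k w ((f ^^ t M) z)"
      using funpow_nonexpansive[OF r(2) mem(1), of n "t M"] by (simp add: n funpow_add)
    then have "k w ((f ^^ n) w) \<le> k w ((f ^^ t (M + N)) z) + k w ((f ^^ t M) z)"
      using k_triangle[OF r(2) mem(1) mem(2), of n "t (M + N)"] k_sym[OF mem(1) mem(2), of "t (M + N)" n] by simp
    also have "\<dots> < e" using M[of M] M[of "M + N"] by simp
    finally show ?thesis using \<open>n \<ge> N\<close> by blast
  qed
  obtain B where B: "\<And>n. k w ((f ^^ n) w) \<le> B" using recurrent_orbit_bounded[OF r(2) rec] by blast
  have "k p ((f ^^ n) z) \<le> k p w + B + k w z" for n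
    using k_triangle[OF p r(2) mem(1), of n] k_triangle[OF r(2) mem(2) mem(1), of n n]
      funpow_nonexpansive[OF r(2) z, of n] B[of n] by linarith
  then show ?thesis by blast
qed

text \<open>The points whose distance to the tail of the orbit is asymptotically at most \<open>B\<close> form a nonempty
  compact set \<open>S\<close>, invariant because one step of the map shifts the orbit, and convex because balls
  are; Brouwer applies to it.\<close>

lemma fixed_point_if_orbit_bounded:
  assumes cont: "continuous_on \<Omega> f" and conv: "\<And>z r. z \<in> \<Omega> \<Longrightarrow> convex {w \<in> \<Omega>. k z w \<le> r}"
    and z: "z \<in> \<Omega>" and B: "\<And>n. k z ((f ^^ n) z) \<le> B"
  obtains x where "x \<in> \<Omega>" and "f x = x"
proof -
  have mem: "(f ^^ m) z \<in> \<Omega>" for m by (rule funpow_mem[OF z])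
  define S where "S = {v \<in> \<Omega>. \<forall>e>0. \<exists>N. \<forall>n\<ge>N. k v ((f ^^ n) z) \<le> B + e}"
  have "k z ((f ^^ n) z) \<le> B + e" if "e > 0" for n e using B[of n] that by simp
  then have "z \<in> S" using z by (simp add: S_def)
  have sub: "S \<subseteq> {v \<in> \<Omega>. k z v \<le> B + (B + 1)}"
  proof
    fix v assume v: "v \<in> S"
    then obtain N where "v \<in> \<Omega>" "\<forall>n\<ge>N. k v ((f ^^ n) z) \<le> B + 1"
      unfolding S_def using zero_less_one by blast
    then show "v \<in> {v \<in> \<Omega>. k z v \<le> B + (B + 1)}"
      using k_triangle[OF z mem[of N], of v] k_sym[OF mem[of N], of v] B[of N] by auto
  qed
  have convS: "convex S"
  proof (rule convexI)
    fix u v and a b :: real assume uv: "u \<in> S" "v \<in> S" and ab: "0 \<le> a" "0 \<le> b" "a + b = 1"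
    have "\<exists>N. \<forall>n\<ge>N. a *\<^sub>R u + b *\<^sub>R v \<in> {w \<in> \<Omega>. k ((f ^^ n) z) w \<le> B + e}" if "e > 0" for e
    proof -
      obtain N where N: "\<forall>n\<ge>N. k u ((f ^^ n) z) \<le> B + e" using uv(1) \<open>e > 0\<close> by (auto simp: S_def)
      obtain M where M: "\<forall>n\<ge>M. k v ((f ^^ n) z) \<le> B + e" using uv(2) \<open>e > 0\<close> by (auto simp: S_def)
      have "u \<in> \<Omega>" "v \<in> \<Omega>" using uv by (auto simp: S_def)
      then show ?thesis
        using N M ab k_sym[OF mem]
        by (intro exI[of _ "max M N"] allI impI convexD[OF conv[OF mem]]) auto
    qed
    note * = this
    have "a *\<^sub>R u + b *\<^sub>R v \<in> \<Omega>" using *[of 1] by auto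
    then show "a *\<^sub>R u + b *\<^sub>R v \<in> S"
      using * k_sym[OF mem] unfolding S_def by fastforce
  qed
  have "v \<in> S" if v: "v \<in> closure S" for v
  proof -
    have "closure S \<subseteq> {v \<in> \<Omega>. k z v \<le> B + (B + 1)}"
      using closure_minimal[OF sub] k_proper[OF z] compact_imp_closed by blast
    with v have vO: "v \<in> \<Omega>" by auto
    have "\<exists>N. \<forall>n\<ge>N. k v ((f ^^ n) z) \<le> B + e" if e: "e > 0" for e
    proof -
      obtain d where d: "d > 0" "\<And>u. dist v u < d \<Longrightarrow> u \<in> \<Omega> \<and> k v u < e / 2"
        using k_small[OF vO, of "e / 2"] e by auto
      obtain u where u: "u \<in> S" "dist u v < d" using v d(1) unfolding closure_approachable by blast
      obtain N where N: "\<And>n. n \<ge> N \<Longrightarrow> k u ((f ^^ n) z) \<le> B + e / 2"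
        using u(1) e by (auto simp: S_def dest!: spec[of _ "e / 2"])
      have "u \<in> \<Omega>" "k v u < e / 2" using d(2)[of u] u(2) by (auto simp: dist_commute)
      then have "k v ((f ^^ n) z) \<le> B + e" if "n \<ge> N" for n
        using N[OF that] k_triangle[OF vO _ mem, of u n] by simp
      then show ?thesis by blast
    qed
    then show ?thesis using vO by (simp add: S_def)
  qed
  then have "closed S" using closure_subset_eq by blast
  moreover have "bounded S" using sub k_proper[OF z] by (metis bounded_subset compact_imp_bounded)
  ultimately have "compact S" by (simp add: compact_eq_bounded_closed)
  moreover have "f \<in> S \<rightarrow> S"
  proof
    fix v assume v: "v \<in> S"
    have vO: "v \<in> \<Omega>" using v by (simp add: S_def)
    have "\<exists>N. \<forall>n\<ge>N. k (f v) ((f ^^ n) z) \<le> B + e" if e: "e > 0" for e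
    proof -
      obtain N where N: "\<And>n. n \<ge> N \<Longrightarrow> k v ((f ^^ n) z) \<le> B + e"
        using v e by (auto simp: S_def)
      have "k (f v) ((f ^^ n) z) \<le> B + e" if n: "n \<ge> Suc N" for n
      proof -
        obtain m where m: "n = Suc m" "m \<ge> N" using n by (cases n) auto
        show ?thesis using bspec[OF bspec[OF f_nonexpansive vO] mem[of m]] N[OF m(2)] by (simp add: m(1))
      qed
      then show ?thesis by blast
    qed
    then show "f v \<in> S" using f_self_map vO by (auto simp: S_def)
  qed
  moreover have "continuous_on S f" by (rule continuous_on_subset[OF cont]) (auto simp: S_def)
  ultimately obtain x where "x \<in> S" "f x = x" using brouwer[of S f] convS \<open>z \<in> S\<close> by blast
  then show ?thesis using that by (auto simp: S_def)
qed

end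

lemma horofunction_limit:
  assumes "tends_to_horofunction \<Omega> k p x h" and "z \<in> \<Omega>"
  shows "(\<lambda>n. k (x n) z - k (x n) p) \<longlonglongrightarrow> h z"
  using tendsto_uniform_limitI[OF tends_to_horofunctionD[OF assms(1), of "{z}"], of z] assms(2) by simp

lemma horofunction_lipschitz:
  assumes x: "\<And>n. x n \<in> \<Omega>"
    and h: "tends_to_horofunction \<Omega> k p x h"
    and zw: "z \<in> \<Omega>" "w \<in> \<Omega>"
  shows "\<bar>h z - h w\<bar> \<le> k z w"
proof (rule tendsto_upperbound)
  show "(\<lambda>n. \<bar>(k (x n) z - k (x n) p) - (k (x n) w - k (x n) p)\<bar>) \<longlonglongrightarrow> \<bar>h z - h w\<bar>"
    by (intro tendsto_intros horofunction_limit[OF h] zw)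
qed (use k_lipschitz[OF x zw] in auto)

text \<open>The Arzela-Ascoli argument. The normalized distance functions are uniformly Lipschitz for \<open>k\<close> but
  bounded only pointwise, by \<open>k p\<close>; the factor \<open>1 / (1 + k p z)\<close> makes the bound uniform, as the
  diagonal argument on a countable dense set requires.\<close>

lemma horofunction_subsequence:
  assumes p: "p \<in> \<Omega>" and x: "\<And>n. x n \<in> \<Omega>"
  obtains r h where "strict_mono (r :: nat \<Rightarrow> nat)"
    and "tends_to_horofunction \<Omega> k p (\<lambda>n. x (r n)) h"
proof -
  define g where "g n z = k (x n) z - k (x n) p" for n z
  have lip: "\<bar>g n z - g n w\<bar> \<le> k z w" if "z \<in> \<Omega>" "w \<in> \<Omega>" for n z w
    using k_lipschitz[OF x that] by (simp add: g_def)
  have g_p: "\<bar>g n z\<bar> \<le> k p z" if "z \<in> \<Omega>" for n z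
    using lip[OF p that, of n] by (simp add: g_def)
  obtain S where S: "countable S" "S \<subseteq> \<Omega>" "\<Omega> \<subseteq> closure S" using separable by metis
  have "norm (g n z / (1 + k p z)) \<le> 1" if "z \<in> S" for n z
    using g_p[of z n] k_nonneg[OF p, of z] that S(2) by (auto simp: divide_simps)
  then obtain r where r: "strict_mono (r :: nat \<Rightarrow> nat)"
      "\<And>z. z \<in> S \<Longrightarrow> \<exists>l. (\<lambda>n. g (r n) z / (1 + k p z)) \<longlonglongrightarrow> l"
    using function_convergent_subsequence[OF S(1), of "\<lambda>n z. g n z / (1 + k p z)" 1] by metis
  have conv_S: "convergent (\<lambda>n. g (r n) z)" if z: "z \<in> S" for z
  proof -
    obtain l where "(\<lambda>n. g (r n) z / (1 + k p z)) \<longlonglongrightarrow> l" using r(2)[OF z] by blast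
    then have "(\<lambda>n. g (r n) z / (1 + k p z) * (1 + k p z)) \<longlonglongrightarrow> l * (1 + k p z)"
      by (intro tendsto_intros)
    moreover have "1 + k p z > 0" using k_nonneg[OF p, of z] z S(2) by auto
    ultimately show ?thesis by (auto simp: convergent_def)
  qed
  have conv: "convergent (\<lambda>n. g (r n) z)" if z: "z \<in> \<Omega>" for z
  proof (rule Cauchy_convergent, rule metric_CauchyI)
    fix e :: real assume e: "e > 0"
    obtain d where d: "d > 0" "\<And>v. dist z v < d \<Longrightarrow> v \<in> \<Omega> \<and> k z v < e / 4"
      using k_small[OF z, of "e / 4"] e by auto
    have "z \<in> closure S" using z S(3) by auto
    then obtain v where v: "v \<in> S" "dist v z < d" using d(1) unfolding closure_approachable by blast
    have vO: "v \<in> \<Omega>" "k z v < e / 4" using d(2)[of v] v(2) by (auto simp: dist_commute)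
    have "Cauchy (\<lambda>n. g (r n) v)" using conv_S[OF v(1)] by (rule convergent_Cauchy)
    then obtain M where M: "\<And>m n. m \<ge> M \<Longrightarrow> n \<ge> M \<Longrightarrow> dist (g (r m) v) (g (r n) v) < e / 2"
      using metric_CauchyD[of _ "e / 2"] e by (metis half_gt_zero)
    have "dist (g (r m) z) (g (r n) z) < e" if "m \<ge> M" "n \<ge> M" for m n
      using M[OF that] lip[OF z vO(1), of "r m"] lip[OF z vO(1), of "r n"] vO(2)
      unfolding dist_real_def by linarith
    then show "\<exists>M. \<forall>m\<ge>M. \<forall>n\<ge>M. dist (g (r m) z) (g (r n) z) < e" by blast
  qed
  define h where "h z = lim (\<lambda>n. g (r n) z)" for z
  have h: "(\<lambda>n. g (r n) z) \<longlonglongrightarrow> h z" if "z \<in> \<Omega>" for z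
    using conv[OF that] by (simp add: h_def convergent_LIMSEQ_iff)
  have lip_h: "\<bar>h z - h w\<bar> \<le> k z w" if "z \<in> \<Omega>" "w \<in> \<Omega>" for z w
  proof (rule tendsto_upperbound)
    show "(\<lambda>n. \<bar>g (r n) z - g (r n) w\<bar>) \<longlonglongrightarrow> \<bar>h z - h w\<bar>"
      using h that by (intro tendsto_intros)
  qed (use lip[OF that] in auto)
  have "uniform_limit K (\<lambda>n z. g (r n) z) h sequentially" if K: "compact K" "K \<subseteq> \<Omega>" for K
  proof (rule uniform_limitI)
    fix e :: real assume e: "e > 0"
    obtain F where F: "finite F" "F \<subseteq> K" "\<And>a. a \<in> K \<Longrightarrow> \<exists>b\<in>F. k b a < e / 3"
      using finite_net[OF K subset_refl, of "e / 3"] e by auto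
    have "\<forall>\<^sub>F n in sequentially. \<forall>b\<in>F. dist (g (r n) b) (h b) < e / 3"
      using F K e by (intro eventually_ball_finite ballI tendstoD h) auto
    then show "\<forall>\<^sub>F n in sequentially. \<forall>z\<in>K. dist (g (r n) z) (h z) < e"
    proof eventually_elim
      case (elim n)
      show ?case
      proof
        fix a assume a: "a \<in> K"
        then obtain b where b: "b \<in> F" "k b a < e / 3" using F(3) by blast
        then have "b \<in> \<Omega>" "a \<in> \<Omega>" using a F K by auto
        then show "dist (g (r n) a) (h a) < e"
          using lip[of b a "r n"] lip_h[of b a] b(2) elim[rule_format, OF b(1)]
          unfolding dist_real_def by linarith
      qed
    qed
  qed
  then have "tends_to_horofunction \<Omega> k p (\<lambda>n. x (r n)) h"
    by (simp add: tends_to_horofunction_def g_def)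
  then show ?thesis by (rule that[OF r(1)])
qed

end

locale proper_length_pseudometric = proper_pseudometric +
  assumes k_split: "z \<in> \<Omega> \<Longrightarrow> w \<in> \<Omega> \<Longrightarrow> k z w < s + t \<Longrightarrow> s \<ge> 0 \<Longrightarrow> t \<ge> 0 \<Longrightarrow>
    \<exists>u\<in>\<Omega>. k z u \<le> s \<and> k u w \<le> t"
begin

text \<open>Going the distance \<open>s\<close> from \<open>z\<close> almost along a geodesic towards a far away \<open>x n\<close> lowers the
  distance to \<open>x n\<close> by nearly \<open>s\<close>. The loss of \<open>3\<close> pays for the approximate geodesic and for
  replacing \<open>h\<close> by its approximation at \<open>z\<close> and at \<open>u\<close>, with an error of \<open>1\<close> each.\<close>

lemma horofunction_descent:
  assumes p: "p \<in> \<Omega>" and x: "\<And>n. x n \<in> \<Omega>"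
    and h: "tends_to_horofunction \<Omega> k p x h"
    and far: "filterlim (\<lambda>n. k p (x n)) at_top sequentially"
    and z: "z \<in> \<Omega>" and s: "s \<ge> 0"
  shows "\<exists>u\<in>\<Omega>. k z u \<le> s \<and> h u \<le> h z - s + 3"
proof -
  define K where "K = {w \<in> \<Omega>. k z w \<le> s}"
  have K: "compact K" "K \<subseteq> \<Omega>" "z \<in> K" using k_proper[OF z] z s k_refl by (auto simp: K_def)
  have "\<forall>\<^sub>F n in sequentially. \<forall>w\<in>K. dist (k (x n) w - k (x n) p) (h w) < 1"
    using uniform_limitD[OF tends_to_horofunctionD[OF h K(1,2)], of 1] by simp
  moreover have "\<forall>\<^sub>F n in sequentially. k p (x n) \<ge> k p z + s"
    using far by (simp add: filterlim_at_top)
  ultimately have "\<forall>\<^sub>F n in sequentially. (\<forall>w\<in>K. dist (k (x n) w - k (x n) p) (h w) < 1) \<and> k p (x n) \<ge> k p z + s"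
    by (rule eventually_conj)
  then obtain n where n: "\<And>w. w \<in> K \<Longrightarrow> dist (k (x n) w - k (x n) p) (h w) < 1" "k p (x n) \<ge> k p z + s"
    by (auto simp: eventually_sequentially)
  have "k z (x n) \<ge> s" using k_triangle[OF p z x, of n] n(2) by linarith
  then obtain u where u: "u \<in> \<Omega>" "k z u \<le> s" "k u (x n) \<le> k z (x n) - s + 1"
    using k_split[OF z x[of n], of s "k z (x n) - s + 1"] s by auto
  then have "u \<in> K" by (simp add: K_def)
  have "h u \<le> h z - s + 3"
    using n(1)[OF \<open>u \<in> K\<close>] n(1)[OF K(3)] u(3) k_sym[OF u(1) x[of n]] k_sym[OF z x[of n]]
    unfolding dist_real_def by linarith
  then show ?thesis using u by blast
qed

end

section \<open>Convex domains with the Kobayashi distance\<close>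

lemma proper_length_kobayashi_dist:
  assumes "open \<Omega>" and "convex \<Omega>" and "bounded \<Omega>"
  shows "proper_length_pseudometric \<Omega> (kobayashi_dist \<Omega>)"
proof
  note oc = assms(1) convex_connected[OF assms(2)]
  show "kobayashi_dist \<Omega> z z = 0" if "z \<in> \<Omega>" for z
    by (rule kobayashi_dist_refl[OF oc that])
  show "kobayashi_dist \<Omega> z w = kobayashi_dist \<Omega> w z" for z w
    by (rule kobayashi_dist_sym)
  show "kobayashi_dist \<Omega> z w \<le> kobayashi_dist \<Omega> z u + kobayashi_dist \<Omega> u w"
    if "z \<in> \<Omega>" "u \<in> \<Omega>" "w \<in> \<Omega>" for z u w
    by (rule kobayashi_dist_triangle[OF oc that])
  show "\<exists>d>0. \<forall>w. dist z w < d \<longrightarrow> w \<in> \<Omega> \<and> kobayashi_dist \<Omega> z w < e"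
    if "z \<in> \<Omega>" "e > 0" for z e
    by (rule kobayashi_dist_small[OF assms(1) that])
  show "compact {w \<in> \<Omega>. kobayashi_dist \<Omega> z w \<le> r}" if "z \<in> \<Omega>" for z r
    by (rule compact_kobayashi_cball[OF assms that])
  show "\<exists>u\<in>\<Omega>. kobayashi_dist \<Omega> z u \<le> s \<and> kobayashi_dist \<Omega> u w \<le> t"
    if "z \<in> \<Omega>" "w \<in> \<Omega>" "kobayashi_dist \<Omega> z w < s + t" "s \<ge> 0" "t \<ge> 0" for z w s t
    by (rule kobayashi_dist_split[OF oc that])
qed

text \<open>The centre is a convex combination of itself with itself, so this is joint convexity of the
  distance applied to two pairs with a common first point.\<close>

lemma convex_kobayashi_cball:
  assumes "open \<Omega>" and "convex \<Omega>" and z: "z \<in> \<Omega>"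
  shows "convex {w \<in> \<Omega>. kobayashi_dist \<Omega> z w \<le> r}"
proof (rule convexI)
  fix u v and a b :: real
  assume uv: "u \<in> {w \<in> \<Omega>. kobayashi_dist \<Omega> z w \<le> r}" "v \<in> {w \<in> \<Omega>. kobayashi_dist \<Omega> z w \<le> r}"
    and ab: "0 \<le> a" "0 \<le> b" "a + b = 1"
  have "a *\<^sub>R z + b *\<^sub>R z = z" using ab by (metis scaleR_add_left scaleR_one)
  then show "a *\<^sub>R u + b *\<^sub>R v \<in> {w \<in> \<Omega>. kobayashi_dist \<Omega> z w \<le> r}"
    using kobayashi_dist_convex[OF assms(1,2) z z, of u v r a b] uv ab convexD[OF assms(2), of u v a b]
    by simp
qed

lemma holomorphic_map_on_continuous_on: "holomorphic_map_on f S \<Longrightarrow> continuous_on S f"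
  unfolding holomorphic_map_on_def continuous_on_eq_continuous_within
  using has_derivative_continuous by blast

lemma holomorphic_map_on_affine:
  assumes "holomorphic_map_on f S"
  shows "holomorphic_map_on (\<lambda>z. a *\<^sub>R f z + b) S"
  unfolding holomorphic_map_on_def
proof
  fix z assume "z \<in> S"
  then obtain D where D: "(f has_derivative D) (at z within S)" "\<And>c v. D (c *s v) = c *s D v"
    using assms by (auto simp: holomorphic_map_on_def)
  have "((\<lambda>z. a *\<^sub>R f z + b) has_derivative (\<lambda>v. a *\<^sub>R D v + 0)) (at z within S)"
    by (intro derivative_intros D(1))
  moreover have "a *\<^sub>R D (c *s v) + 0 = c *s (a *\<^sub>R D v + 0)" for c v
    by (simp add: D(2) vec_eq_iff)
  ultimately show "\<exists>D. ((\<lambda>z. a *\<^sub>R f z + b) has_derivative D) (at z within S) \<and> (\<forall>c v. D (c *s v) = c *s D v)"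
    by blast
qed

text \<open>The image of the closure of \<open>S\<close> under a contraction towards an interior point is a compact convex
  subset of \<open>S\<close>, which the map preserves.\<close>

lemma contracted_map_fixed_point:
  fixes S :: "'a::euclidean_space set"
  assumes "open S" and "convex S" and "bounded S" and p: "p \<in> S"
    and f: "continuous_on S f" "f \<in> S \<rightarrow> S" and t: "0 < t" "t \<le> 1"
  shows "\<exists>x\<in>S. (1 - t) *\<^sub>R f x + t *\<^sub>R p = x"
proof -
  define T where "T = (\<lambda>x. t *\<^sub>R p + (1 - t) *\<^sub>R x) ` closure S"
  have TS: "T \<subseteq> S"
  proof
    fix v assume "v \<in> T"
    then obtain x where x: "x \<in> closure S" "v = t *\<^sub>R p + (1 - t) *\<^sub>R x" by (auto simp: T_def)
    have "x - t *\<^sub>R (x - p) \<in> interior S"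
      using mem_interior_closure_convex_shrink[OF assms(2) _ x(1) t] assms(1) p by (simp add: interior_open)
    moreover have "v = x - t *\<^sub>R (x - p)" by (simp add: x(2) algebra_simps)
    ultimately show "v \<in> S" using interior_subset by auto
  qed
  have "compact T" unfolding T_def using assms(3)
    by (intro compact_continuous_image continuous_intros) (simp add: compact_closure)
  moreover have "convex T" unfolding T_def by (intro convex_affinity convex_closure assms(2))
  moreover have "T \<noteq> {}" using p by (auto simp: T_def)
  moreover have "continuous_on T (\<lambda>x. (1 - t) *\<^sub>R f x + t *\<^sub>R p)"
    using continuous_on_subset[OF f(1) TS] by (intro continuous_intros)
  moreover have "(\<lambda>x. (1 - t) *\<^sub>R f x + t *\<^sub>R p) \<in> T \<rightarrow> T"
  proof
    fix x assume "x \<in> T"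
    then have "f x \<in> closure S" using TS f(2) closure_subset by blast
    then show "(1 - t) *\<^sub>R f x + t *\<^sub>R p \<in> T" by (auto simp: T_def add.commute)
  qed
  ultimately obtain x where "x \<in> T" "(1 - t) *\<^sub>R f x + t *\<^sub>R p = x" by (rule brouwer)
  then show ?thesis using TS by blast
qed

lemma tendsto_if_subsequential_limits:
  fixes x :: "nat \<Rightarrow> 'a::metric_space"
  assumes "compact S" and "\<And>n. x n \<in> S"
    and lim: "\<And>r l'. strict_mono (r :: nat \<Rightarrow> nat) \<Longrightarrow> l' \<in> S \<Longrightarrow> (\<lambda>n. x (r n)) \<longlonglongrightarrow> l' \<Longrightarrow> l' = l"
  shows "x \<longlonglongrightarrow> l"
proof (rule ccontr)
  assume "\<not> x \<longlonglongrightarrow> l"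
  then obtain e where e: "e > 0" "\<not> (\<forall>\<^sub>F n in sequentially. dist (x n) l < e)"
    by (auto simp: tendsto_iff)
  then have "infinite {n. dist (x n) l \<ge> e}"
    by (simp add: cofinite_eq_sequentially[symmetric] eventually_cofinite not_less)
  then obtain s :: "nat \<Rightarrow> nat" where s: "strict_mono s" "\<And>n. dist (x (s n)) l \<ge> e"
    using infinite_enumerate by blast
  obtain l' r where r: "l' \<in> S" "strict_mono (r :: nat \<Rightarrow> nat)" "((\<lambda>n. x (s n)) \<circ> r) \<longlonglongrightarrow> l'"
    using seq_compactE[OF compact_imp_seq_compact[OF assms(1)], of "\<lambda>n. x (s n)"] assms(2) by metis
  have "(\<lambda>n. x ((s \<circ> r) n)) \<longlonglongrightarrow> l'" using r(3) by (simp add: o_def)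
  then have "l' = l" using lim[OF strict_mono_o[OF s(1) r(2)] r(1)] by blast
  then have "\<forall>\<^sub>F n in sequentially. dist (x (s (r n))) l < e" using tendstoD[OF r(3) e(1)] by (simp add: o_def)
  then show False using s(2) by (auto simp: eventually_sequentially not_less[symmetric])
qed

section \<open>Horofunctions of the Kobayashi distance\<close>

lemma topspace_cont_funs_mod_const:
  "topspace (cont_funs_mod_const_topology \<Omega>) = cont_funs \<Omega> // const_rel \<Omega>"
proof (rule antisym)
  show "topspace (cont_funs_mod_const_topology \<Omega>) \<subseteq> cont_funs \<Omega> // const_rel \<Omega>"
    using openin_topspace[of "cont_funs_mod_const_topology \<Omega>"]
    by (simp only: openin_cont_funs_mod_const_topology)
  have "openin (loc_unif_topology \<Omega>) (cont_funs \<Omega>)"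
    unfolding openin_loc_unif_topology
    by (auto intro!: exI[of _ "{}"] exI[of _ "1 :: real"])
  then have "openin (cont_funs_mod_const_topology \<Omega>) (cont_funs \<Omega> // const_rel \<Omega>)"
    by (simp add: openin_cont_funs_mod_const_topology Union_quotient[OF equiv_const_rel])
  then show "cont_funs \<Omega> // const_rel \<Omega> \<subseteq> topspace (cont_funs_mod_const_topology \<Omega>)"
    by (rule openin_subset)
qed

text \<open>Neighbourhoods in the quotient topology pull back to neighbourhoods of uniform convergence on
  compact sets, so the class of \<open>h\<close> is a limit of the classes of \<open>x n\<close>. It is not the class
  of a point of the domain, as the distance to a point is bounded below.\<close>

lemma metric_boundary_of_horofunction:
  assumes \<Omega>: "open \<Omega>" "convex \<Omega>" "bounded \<Omega>" and p: "p \<in> \<Omega>" and x: "\<And>n. x n \<in> \<Omega>"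
    and h: "tends_to_horofunction \<Omega> (kobayashi_dist \<Omega>) p x h"
    and unbounded: "\<And>c. \<exists>u\<in>\<Omega>. h u < c"
  shows "\<exists>\<xi>\<in>metric_boundary \<Omega>. \<forall>z\<in>\<Omega>. horofunction p \<xi> z = h z"
proof -
  interpret proper_length_pseudometric \<Omega> "kobayashi_dist \<Omega>"
    by (rule proper_length_kobayashi_dist[OF \<Omega>])
  note eq = equiv_const_rel[of \<Omega>]
  have cont: "restrict g \<Omega> \<in> cont_funs \<Omega>"
    if "\<And>z w. z \<in> \<Omega> \<Longrightarrow> w \<in> \<Omega> \<Longrightarrow> \<bar>g z - g w\<bar> \<le> kobayashi_dist \<Omega> z w" for g
    using k_lipschitz_continuous_on[of g] that by (simp add: cont_funs_def cong: continuous_on_cong)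
  have h_cont: "restrict h \<Omega> \<in> cont_funs \<Omega>"
    by (rule cont) (rule horofunction_lipschitz[OF x h])
  have k_cont: "restrict (kobayashi_dist \<Omega> u) \<Omega> \<in> cont_funs \<Omega>" if "u \<in> \<Omega>" for u
    by (rule cont) (rule k_lipschitz[OF that])
  have "(\<lambda>n. kobayashi_dist \<Omega> (x n) p - kobayashi_dist \<Omega> (x n) p) \<longlonglongrightarrow> h p"
    by (rule horofunction_limit[OF h p])
  then have hp: "h p = 0" by (simp add: LIMSEQ_const_iff)
  define \<xi> where "\<xi> = const_rel \<Omega> `` {restrict h \<Omega>}"
  have \<xi>: "\<xi> \<in> cont_funs \<Omega> // const_rel \<Omega>" "restrict h \<Omega> \<in> \<xi>"
    using quotientI[OF h_cont] equiv_class_self[OF eq h_cont] by (auto simp: \<xi>_def)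
  have "\<xi> \<in> metric_compactification \<Omega>"
    unfolding metric_compactification_def in_closure_of topspace_cont_funs_mod_const
  proof (intro conjI \<xi>(1) allI impI)
    fix U assume U: "\<xi> \<in> U \<and> openin (cont_funs_mod_const_topology \<Omega>) U"
    then have "restrict h \<Omega> \<in> \<Union>U" using \<xi>(2) by blast
    then obtain K \<epsilon> where K: "compact K" "K \<subseteq> \<Omega>" "\<epsilon> > 0"
        "{g \<in> cont_funs \<Omega>. \<forall>x\<in>K. \<bar>g x - restrict h \<Omega> x\<bar> < \<epsilon>} \<subseteq> \<Union>U"
      using U unfolding openin_cont_funs_mod_const_topology openin_loc_unif_topology by blast
    obtain n where n: "\<And>z. z \<in> K \<Longrightarrow> dist (kobayashi_dist \<Omega> (x n) z - kobayashi_dist \<Omega> (x n) p) (h z) < \<epsilon>"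
      using uniform_limitD[OF tends_to_horofunctionD[OF h K(1,2)] K(3)] by (auto simp: eventually_sequentially)
    define g where "g = restrict (\<lambda>z. kobayashi_dist \<Omega> (x n) z - kobayashi_dist \<Omega> (x n) p) \<Omega>"
    have g: "g \<in> cont_funs \<Omega>" unfolding g_def
      by (rule cont) (use k_lipschitz[OF x] in simp)
    have "g \<in> \<Union>U"
      using K(2,4) g n by (auto simp: g_def dist_real_def subset_iff)
    then obtain X where X: "X \<in> U" "g \<in> X" by blast
    then have "X \<in> cont_funs \<Omega> // const_rel \<Omega>"
      using U by (auto simp: openin_cont_funs_mod_const_topology)
    moreover have "metric_embedding \<Omega> (x n) \<in> cont_funs \<Omega> // const_rel \<Omega>"
      unfolding metric_embedding_def by (rule quotientI[OF k_cont[OF x]])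
    moreover have "g \<in> metric_embedding \<Omega> (x n)"
      using k_cont[OF x[of n]] g by (auto simp: metric_embedding_def const_rel_def g_def
          intro!: exI[of _ "- kobayashi_dist \<Omega> (x n) p"])
    ultimately have "X = metric_embedding \<Omega> (x n)" using quotient_disj[OF eq] X(2) by blast
    then show "\<exists>y. y \<in> metric_embedding \<Omega> ` \<Omega> \<and> y \<in> U" using X(1) x by blast
  qed
  moreover have "\<xi> \<notin> metric_embedding \<Omega> ` \<Omega>"
  proof
    assume "\<xi> \<in> metric_embedding \<Omega> ` \<Omega>"
    then obtain w where w: "w \<in> \<Omega>" "restrict h \<Omega> \<in> metric_embedding \<Omega> w" using \<xi>(2) by auto
    then obtain c where c: "\<forall>z\<in>\<Omega>. restrict h \<Omega> z = restrict (kobayashi_dist \<Omega> w) \<Omega> z + c"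
      by (auto simp: metric_embedding_def const_rel_def)
    obtain u where "u \<in> \<Omega>" "h u < c" using unbounded by blast
    then show False using c k_nonneg[OF w(1), of u] by auto
  qed
  ultimately have "\<xi> \<in> metric_boundary \<Omega>" by (simp add: metric_boundary_def)
  moreover have "horofunction p \<xi> = restrict h \<Omega>"
    unfolding horofunction_def
    by (rule the1_equality[OF ex1_horofunction[OF p \<xi>(1)]]) (use \<xi>(2) p hp in simp)
  ultimately show ?thesis by (intro bexI[of _ \<xi>]) auto
qed

text \<open>A limit point of \<open>u\<close> inside the domain would keep \<open>z\<close> in a compact set by properness, and one on
  the boundary different from \<open>v\<close> would make the distances between \<open>z n\<close> and \<open>u n\<close> unbounded.\<close>

lemma boundary_limit_of_bounded_distance:
  assumes \<Omega>: "open \<Omega>" "convex \<Omega>" "bounded \<Omega>"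
    and sep: "\<And>x y. x \<in> frontier \<Omega> \<Longrightarrow> y \<in> frontier \<Omega> \<Longrightarrow> x \<noteq> y \<Longrightarrow>
           filterlim (\<lambda>(z, w). kobayashi_dist \<Omega> z w) at_top (at (x, y) within \<Omega> \<times> \<Omega>)"
    and z: "\<And>n. z n \<in> \<Omega>" "z \<longlonglongrightarrow> v" "v \<in> frontier \<Omega>" and u: "\<And>n. u n \<in> \<Omega>"
    and C: "\<And>n. kobayashi_dist \<Omega> (z n) (u n) \<le> C"
  shows "u \<longlonglongrightarrow> v"
proof (rule tendsto_if_subsequential_limits)
  interpret proper_length_pseudometric \<Omega> "kobayashi_dist \<Omega>"
    by (rule proper_length_kobayashi_dist[OF \<Omega>])
  show "compact (closure \<Omega>)" using \<Omega>(3) by simp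
  show "u n \<in> closure \<Omega>" for n using u closure_subset by blast
  fix r q assume r: "strict_mono (r :: nat \<Rightarrow> nat)" and q: "q \<in> closure \<Omega>" "(\<lambda>n. u (r n)) \<longlonglongrightarrow> q"
  have zr: "(\<lambda>n. z (r n)) \<longlonglongrightarrow> v" using LIMSEQ_subseq_LIMSEQ[OF z(2) r] by (simp add: o_def)
  have v: "v \<notin> \<Omega>" using z(3) \<Omega>(1) by (simp add: frontier_def interior_open)
  have qf: "q \<in> frontier \<Omega>"
  proof (rule ccontr)
    assume "q \<notin> frontier \<Omega>"
    then have qO: "q \<in> \<Omega>" using q(1) \<Omega>(1) by (simp add: frontier_def interior_open)
    have "\<forall>\<^sub>F n in sequentially. kobayashi_dist \<Omega> q (u (r n)) < 1"
      using order_tendstoD(2)[OF k_tendsto_0[OF q(2) qO], of 1] by simp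
    then have "\<forall>\<^sub>F n in sequentially. z (r n) \<in> {w \<in> \<Omega>. kobayashi_dist \<Omega> q w \<le> 1 + C}"
    proof eventually_elim
      case (elim n)
      then show ?case
        using z(1) C[of "r n"] k_triangle[OF qO u z(1), of "r n" "r n"] k_sym[OF u z(1), of "r n" "r n"] by simp
    qed
    then have "v \<in> {w \<in> \<Omega>. kobayashi_dist \<Omega> q w \<le> 1 + C}"
      using zr compact_imp_closed[OF k_proper[OF qO]] by (intro Lim_in_closed_set) auto
    then show False using v by simp
  qed
  show "q = v"
  proof (rule ccontr)
    assume "q \<noteq> v"
    have "filterlim (\<lambda>n. (z (r n), u (r n))) (at (v, q) within \<Omega> \<times> \<Omega>) sequentially"
      unfolding filterlim_at using tendsto_Pair[OF zr q(2)] z(1) u v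
      by (auto intro!: always_eventually)
    then have "filterlim (\<lambda>n. kobayashi_dist \<Omega> (z (r n)) (u (r n))) at_top sequentially"
      using filterlim_compose[OF sep[OF z(3) qf]] \<open>q \<noteq> v\<close> by fastforce
    then have "\<forall>\<^sub>F n in sequentially. kobayashi_dist \<Omega> (z (r n)) (u (r n)) \<ge> C + 1"
      by (simp add: filterlim_at_top)
    then obtain n where "kobayashi_dist \<Omega> (z (r n)) (u (r n)) \<ge> C + 1"
      by (auto simp: eventually_sequentially)
    then show False using C[of "r n"] by simp
  qed
qed

text \<open>The horofunction is the limit of the distances to fixed points of the maps
  \<open>(1 - t) f + t p\<close>. These maps do not increase the distance to their fixed point, and they tend
  to \<open>f\<close>, so \<open>f\<close> does not increase the limit.\<close>

lemma invariant_horofunction: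
  assumes \<Omega>: "open \<Omega>" "convex \<Omega>" "bounded \<Omega>" and p: "p \<in> \<Omega>"
    and f: "holomorphic_map_on f \<Omega>" "f \<in> \<Omega> \<rightarrow> \<Omega>" and nofix: "\<And>x. x \<in> \<Omega> \<Longrightarrow> f x \<noteq> x"
  obtains y h where "\<And>n. y n \<in> \<Omega>" and "filterlim (\<lambda>n. kobayashi_dist \<Omega> p (y n)) at_top sequentially"
    and "tends_to_horofunction \<Omega> (kobayashi_dist \<Omega>) p y h"
    and "\<And>z. z \<in> \<Omega> \<Longrightarrow> h (f z) \<le> h z"
proof -
  interpret proper_length_pseudometric \<Omega> "kobayashi_dist \<Omega>"
    by (rule proper_length_kobayashi_dist[OF \<Omega>])
  note conn = convex_connected[OF \<Omega>(2)]
  note cont = holomorphic_map_on_continuous_on[OF f(1)]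
  define t where "t n = inverse (real (Suc n))" for n
  have t: "0 < t n" "t n \<le> 1" for n by (auto simp: t_def field_simps)
  have t0: "t \<longlonglongrightarrow> 0" unfolding t_def by (rule LIMSEQ_inverse_real_of_nat)
  define F where "F n z = (1 - t n) *\<^sub>R f z + t n *\<^sub>R p" for n z
  have F_tendsto: "(\<lambda>n. F (s n) (v n)) \<longlonglongrightarrow> l"
    if "(\<lambda>n. f (v n)) \<longlonglongrightarrow> l" "(\<lambda>n. t (s n)) \<longlonglongrightarrow> 0" for s v l
    using tendsto_add[OF tendsto_scaleR[OF tendsto_diff[OF tendsto_const[of 1] that(2)] that(1)]
        tendsto_scaleR[OF that(2) tendsto_const[of p]]]
    by (simp add: F_def)
  have F_mem: "F n \<in> \<Omega> \<rightarrow> \<Omega>" for n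
  proof
    fix z assume "z \<in> \<Omega>"
    then have "f z \<in> \<Omega>" using f(2) by blast
    then show "F n z \<in> \<Omega>" unfolding F_def using t[of n] by (intro convexD[OF \<Omega>(2) _ p]) auto
  qed
  have F_hol: "holomorphic_map_on (F n) \<Omega>" for n
    unfolding F_def using holomorphic_map_on_affine[OF f(1)] by simp
  have "\<exists>x\<in>\<Omega>. F n x = x" for n
    using contracted_map_fixed_point[OF \<Omega> p cont f(2) t[of n]] by (simp add: F_def)
  then obtain x where x: "\<And>n. x n \<in> \<Omega>" "\<And>n. F n (x n) = x n" by metis
  have far: "filterlim (\<lambda>n. kobayashi_dist \<Omega> p (x n)) at_top sequentially"
  proof (rule ccontr)
    assume "\<not> ?thesis"
    then obtain C where "\<not> (\<forall>\<^sub>F n in sequentially. C \<le> kobayashi_dist \<Omega> p (x n))"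
      by (auto simp: filterlim_at_top)
    then have "infinite {n. kobayashi_dist \<Omega> p (x n) < C}"
      by (simp add: cofinite_eq_sequentially[symmetric] eventually_cofinite not_le)
    then obtain s :: "nat \<Rightarrow> nat" where s: "strict_mono s" "\<And>n. kobayashi_dist \<Omega> p (x (s n)) < C"
      using infinite_enumerate by blast
    obtain r l where r: "strict_mono (r :: nat \<Rightarrow> nat)" "l \<in> \<Omega>" "(\<lambda>n. x (s (r n))) \<longlonglongrightarrow> l"
      using bounded_sequence_subconverges[OF p, of "\<lambda>n. x (s n)" C] x(1) less_imp_le[OF s(2)] by blast
    have "(\<lambda>n. f (x (s (r n)))) \<longlonglongrightarrow> f l"
      using continuous_on_tendsto_compose[OF cont r(3,2)] x(1) by simp
    moreover have "(\<lambda>n. t (s (r n))) \<longlonglongrightarrow> 0"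
      using LIMSEQ_subseq_LIMSEQ[OF t0 strict_mono_o[OF s(1) r(1)]] by (simp add: o_def)
    ultimately have "(\<lambda>n. F (s (r n)) (x (s (r n)))) \<longlonglongrightarrow> f l"
      by (rule F_tendsto[of "\<lambda>n. x (s (r n))" "f l" "\<lambda>n. s (r n)"])
    then have "(\<lambda>n. x (s (r n))) \<longlonglongrightarrow> f l" by (simp only: x(2))
    then have "f l = l" by (rule LIMSEQ_unique[OF _ r(3)])
    then show False using nofix r(2) by blast
  qed
  obtain r h where r: "strict_mono (r :: nat \<Rightarrow> nat)" and h: "tends_to_horofunction \<Omega> (kobayashi_dist \<Omega>) p (\<lambda>n. x (r n)) h"
    using horofunction_subsequence[OF p x(1)] .
  have "h (f z) \<le> h z" if z: "z \<in> \<Omega>" for z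
  proof -
    have fz: "f z \<in> \<Omega>" using f(2) z by blast
    have "(\<lambda>n. t (r n)) \<longlonglongrightarrow> 0" using LIMSEQ_subseq_LIMSEQ[OF t0 r] by (simp add: o_def)
    then have "(\<lambda>n. F (r n) z) \<longlonglongrightarrow> f z" using F_tendsto[of "\<lambda>_. z" "f z" r] by simp
    then have "(\<lambda>n. kobayashi_dist \<Omega> (f z) (F (r n) z)) \<longlonglongrightarrow> 0"
      by (rule k_tendsto_0[OF _ fz])
    then have lim: "(\<lambda>n. (kobayashi_dist \<Omega> (x (r n)) z - kobayashi_dist \<Omega> (x (r n)) p)
        + kobayashi_dist \<Omega> (f z) (F (r n) z)) \<longlonglongrightarrow> h z + 0"
      by (intro tendsto_add horofunction_limit[OF h z])
    have "kobayashi_dist \<Omega> (x (r n)) (f z) - kobayashi_dist \<Omega> (x (r n)) p \<le>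
        (kobayashi_dist \<Omega> (x (r n)) z - kobayashi_dist \<Omega> (x (r n)) p) + kobayashi_dist \<Omega> (f z) (F (r n) z)" for n
    proof -
      have Fz: "F (r n) z \<in> \<Omega>" using F_mem z by blast
      have "kobayashi_dist \<Omega> (x (r n)) (F (r n) z) \<le> kobayashi_dist \<Omega> (x (r n)) z"
        using kobayashi_dist_nonexpansive[OF \<Omega>(1) conn F_hol F_mem x(1) z, of "r n" "r n"] by (simp add: x(2))
      then show ?thesis
        using k_triangle[OF x(1) Fz fz, of "r n"] k_sym[OF fz Fz] by simp
    qed
    then have "h (f z) \<le> h z + 0"
      by (intro LIMSEQ_le[OF horofunction_limit[OF h fz] lim]) auto
    then show ?thesis by simp
  qed
  moreover have "filterlim (\<lambda>n. kobayashi_dist \<Omega> p (x (r n))) at_top sequentially"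
    by (rule filterlim_compose[OF far filterlim_subseq[OF r]])
  ultimately show ?thesis using that[of "\<lambda>n. x (r n)" h] x(1) h by blast
qed

lemma not_uniform_limit_sequence:
  assumes "\<not> uniform_limit K g l sequentially"
  shows "\<exists>e>0. \<exists>(s :: nat \<Rightarrow> nat) z. strict_mono s \<and> (\<forall>n. z n \<in> K \<and> dist (g (s n) (z n)) (l (z n)) \<ge> e)"
proof -
  obtain e where e: "e > 0" "\<not> (\<forall>\<^sub>F n in sequentially. \<forall>z\<in>K. dist (g n z) (l z) < e)"
    using assms by (auto simp: uniform_limit_iff)
  then have "infinite {n. \<exists>z\<in>K. dist (g n z) (l z) \<ge> e}"
    by (simp add: cofinite_eq_sequentially[symmetric] eventually_cofinite not_less)
  then obtain s :: "nat \<Rightarrow> nat" where "strict_mono s" "\<And>n. \<exists>z\<in>K. dist (g (s n) z) (l z) \<ge> e"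
    using infinite_enumerate by blast
  then show ?thesis using e(1) by metis
qed

section \<open>The Denjoy-Wolff theorem\<close>

theorem proposition1p7:
  fixes \<Omega> :: "(complex ^ 'd) set" and p :: "complex ^ 'd"
    and f :: "complex ^ 'd \<Rightarrow> complex ^ 'd"
  assumes "open \<Omega>" and "connected \<Omega>" and "bounded \<Omega>" and "convex \<Omega>"
    and "\<And>x y. x \<in> frontier \<Omega> \<Longrightarrow> y \<in> frontier \<Omega> \<Longrightarrow> x \<noteq> y \<Longrightarrow>
           filterlim (\<lambda>(z, w). kobayashi_dist \<Omega> z w) at_top (at (x, y) within \<Omega> \<times> \<Omega>)"
    and "p \<in> \<Omega>"
    and "\<And>\<xi>. \<xi> \<in> metric_boundary \<Omega> \<Longrightarrow>
           is_singleton (\<Inter>R\<in>{0<..}. closure (horoball \<Omega> p \<xi> R))"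
    and "holomorphic_map_on f \<Omega>" and "f \<in> \<Omega> \<rightarrow> \<Omega>"
  shows "(\<exists>x\<in>\<Omega>. f x = x) \<or>
         (\<exists>y\<in>frontier \<Omega>. \<forall>K. compact K \<and> K \<subseteq> \<Omega> \<longrightarrow>
            uniform_limit K (\<lambda>n. f ^^ n) (\<lambda>_. y) sequentially)"
proof (cases "\<exists>x\<in>\<Omega>. f x = x")
  case False
  then have nofix: "\<And>x. x \<in> \<Omega> \<Longrightarrow> f x \<noteq> x" by blast
  note \<Omega> = assms(1,4,3) and sep = assms(5) and p = assms(6)
  interpret proper_length_pseudometric \<Omega> "kobayashi_dist \<Omega>"
    by (rule proper_length_kobayashi_dist[OF \<Omega>])
  have f_nonexp: "\<forall>z\<in>\<Omega>. \<forall>w\<in>\<Omega>. kobayashi_dist \<Omega> (f z) (f w) \<le> kobayashi_dist \<Omega> z w"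
    using kobayashi_dist_nonexpansive[OF assms(1,2,8,9)] by blast
  have mem: "(f ^^ n) z \<in> \<Omega>" if "z \<in> \<Omega>" for n z using funpow_mem[where f = f, OF assms(9) f_nonexp that] .
  obtain x h where x: "\<And>n. x n \<in> \<Omega>" and far: "filterlim (\<lambda>n. kobayashi_dist \<Omega> p (x n)) at_top sequentially"
    and h: "tends_to_horofunction \<Omega> (kobayashi_dist \<Omega>) p x h"
    and h_f: "\<And>z. z \<in> \<Omega> \<Longrightarrow> h (f z) \<le> h z"
    using invariant_horofunction[OF \<Omega> p assms(8,9) nofix] by blast
  note descent = horofunction_descent[OF p x h far]
  have unbounded: "\<exists>u\<in>\<Omega>. h u < c" for c
  proof -
    obtain u where "u \<in> \<Omega>" "h u \<le> h p - max 0 (h p - c + 4) + 3"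
      using descent[OF p, of "max 0 (h p - c + 4)"] by auto
    then show ?thesis by (intro bexI[of _ u]) auto
  qed
  obtain \<xi> where \<xi>: "\<xi> \<in> metric_boundary \<Omega>" "\<And>z. z \<in> \<Omega> \<Longrightarrow> horofunction p \<xi> z = h z"
    using metric_boundary_of_horofunction[OF \<Omega> p x h unbounded] by blast
  have horoball_eq: "horoball \<Omega> p \<xi> R = {z \<in> \<Omega>. h z < 1 / 2 * ln R}" for R
    using \<xi>(2) by (auto simp: horoball_def)
  obtain y where y: "(\<Inter>R\<in>{0<..}. closure {z \<in> \<Omega>. h z < 1 / 2 * ln R}) = {y}"
    using assms(7)[OF \<xi>(1)] by (auto simp: horoball_eq is_singleton_def)
  \<comment> \<open>Moving a sequence of a horoball by a bounded distance puts it into a smaller horoball without changing its limit on the boundary.\<close>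
  have boundary_limit: "v = y" if v: "v \<in> frontier \<Omega>" and z: "\<And>n. z n \<in> \<Omega>" "z \<longlonglongrightarrow> v" "\<And>n. h (z n) \<le> c" for v z c
  proof -
    have "v \<in> closure {z \<in> \<Omega>. h z < 1 / 2 * ln R}" if "R > 0" for R
    proof -
      \<comment> \<open>The distance that takes \<open>h\<close> from \<open>c\<close> to below \<open>ln R / 2\<close>, including the loss of \<open>3\<close> in the descent.\<close>
      define s where "s = max 0 (c - 1 / 2 * ln R + 4)"
      have "\<exists>u. \<forall>n. u n \<in> \<Omega> \<and> kobayashi_dist \<Omega> (z n) (u n) \<le> s \<and> h (u n) \<le> h (z n) - s + 3"
        using descent[OF z(1), of s] by (intro choice) (auto simp: s_def)
      then obtain u where u: "\<And>n. u n \<in> \<Omega>" "\<And>n. kobayashi_dist \<Omega> (z n) (u n) \<le> s"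
          "\<And>n. h (u n) \<le> h (z n) - s + 3" by blast
      have "u \<longlonglongrightarrow> v" by (rule boundary_limit_of_bounded_distance[OF \<Omega> sep z(1,2) v u(1,2)])
      moreover have "u n \<in> {z \<in> \<Omega>. h z < 1 / 2 * ln R}" for n
        using u(1)[of n] u(3)[of n] z(3)[of n] by (auto simp: s_def)
      ultimately show ?thesis unfolding closure_sequential by blast
    qed
    then have "v \<in> (\<Inter>R\<in>{0<..}. closure {z \<in> \<Omega>. h z < 1 / 2 * ln R})" by auto
    then show ?thesis unfolding y by simp
  qed
  have h_orbit: "h ((f ^^ n) p) \<le> h p" for n
  proof (induction n)
    case (Suc n)
    then show ?case using h_f[OF mem[OF p, of n]] by simp
  qed simp
  have escape: "finite {n. kobayashi_dist \<Omega> p ((f ^^ n) p) \<le> C}" for C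
  proof (rule ccontr)
    assume "infinite {n. kobayashi_dist \<Omega> p ((f ^^ n) p) \<le> C}"
    then obtain B where "\<And>n. kobayashi_dist \<Omega> p ((f ^^ n) p) \<le> B"
      using Calka_bounded_orbit[where f = f, OF assms(9) f_nonexp p p] by blast
    then obtain q where "q \<in> \<Omega>" "f q = q"
      using fixed_point_if_orbit_bounded[where f = f, OF assms(9) f_nonexp holomorphic_map_on_continuous_on[OF assms(8)]
          convex_kobayashi_cball[OF \<Omega>(1,2)] p] by blast
    then show False using nofix by blast
  qed
  have limit_in_frontier: "q \<in> frontier \<Omega>"
    if r: "strict_mono (r :: nat \<Rightarrow> nat)" and q: "(\<lambda>n. (f ^^ r n) p) \<longlonglongrightarrow> q" for r q
  proof -
    have "q \<notin> \<Omega>"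
    proof
      assume qO: "q \<in> \<Omega>"
      have "\<forall>\<^sub>F n in sequentially. kobayashi_dist \<Omega> q ((f ^^ r n) p) < 1"
        using order_tendstoD(2)[OF k_tendsto_0[OF q qO], of 1] by simp
      then obtain N where N: "\<And>n. n \<ge> N \<Longrightarrow> kobayashi_dist \<Omega> q ((f ^^ r n) p) < 1"
        by (auto simp: eventually_sequentially)
      have "r ` {N..} \<subseteq> {n. kobayashi_dist \<Omega> p ((f ^^ n) p) \<le> kobayashi_dist \<Omega> p q + 1}"
        using N k_triangle[OF p qO mem[OF p]] by (force intro: order_trans)
      then have "finite (r ` {N..})" using escape by (rule finite_subset)
      then show False
        using strict_mono_imp_inj_on[OF r] by (simp add: finite_image_iff inj_on_subset infinite_Ici)
    qed
    moreover have "q \<in> closure \<Omega>"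
      unfolding closure_sequential using q mem[OF p] by (intro exI[of _ "\<lambda>n. (f ^^ r n) p"]) simp
    ultimately show ?thesis using \<Omega>(1) by (simp add: frontier_def interior_open)
  qed
  have orbit: "(\<lambda>n. (f ^^ n) p) \<longlonglongrightarrow> y"
  proof (rule tendsto_if_subsequential_limits)
    show "compact (closure \<Omega>)" using \<Omega>(3) by simp
    show "(f ^^ n) p \<in> closure \<Omega>" for n using mem[OF p] closure_subset by blast
    fix r q assume r: "strict_mono (r :: nat \<Rightarrow> nat)" and q: "(\<lambda>n. (f ^^ r n) p) \<longlonglongrightarrow> q"
    show "q = y"
      by (rule boundary_limit[OF limit_in_frontier[OF r q] mem[OF p] q h_orbit])
  qed
  have yf: "y \<in> frontier \<Omega>"
    using limit_in_frontier[OF strict_mono_id] orbit by simp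
  have "uniform_limit K (\<lambda>n. f ^^ n) (\<lambda>_. y) sequentially" if K: "compact K" "K \<subseteq> \<Omega>" for K
  proof (rule ccontr)
    assume "\<not> ?thesis"
    then obtain e s z where e: "e > 0" and s: "strict_mono (s :: nat \<Rightarrow> nat)" and z: "\<And>n. z n \<in> K"
      and dist: "\<And>n. dist ((f ^^ s n) (z n)) y \<ge> e"
      using not_uniform_limit_sequence by blast
    have "continuous_on K (kobayashi_dist \<Omega> p)"
      by (rule continuous_on_subset[OF k_lipschitz_continuous_on K(2)]) (rule k_lipschitz[OF p])
    then have "bdd_above (kobayashi_dist \<Omega> p ` K)"
      using K(1) by (intro bounded_imp_bdd_above compact_imp_bounded compact_continuous_image)
    then obtain C where C: "\<And>w. w \<in> K \<Longrightarrow> kobayashi_dist \<Omega> p w \<le> C" by (auto simp: bdd_above_def)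
    have zO: "z n \<in> \<Omega>" for n using z K(2) by blast
    have "(\<lambda>n. (f ^^ s n) (z n)) \<longlonglongrightarrow> y"
    proof (rule boundary_limit_of_bounded_distance[OF \<Omega> sep])
      show "(\<lambda>n. (f ^^ s n) p) \<longlonglongrightarrow> y" using LIMSEQ_subseq_LIMSEQ[OF orbit s] by (simp add: o_def)
      show "kobayashi_dist \<Omega> ((f ^^ s n) p) ((f ^^ s n) (z n)) \<le> C" for n
        using funpow_nonexpansive[where f = f, OF assms(9) f_nonexp p zO, of "s n" n] C[OF z[of n]] by linarith
    qed (use mem p zO yf in auto)
    then have "\<forall>\<^sub>F n in sequentially. dist ((f ^^ s n) (z n)) y < e" using e by (rule tendstoD)
    then show False using dist by (auto simp: eventually_sequentially not_less[symmetric])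
  qed
  then show ?thesis using yf by blast
qed blast

end
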